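(* If every pair of binary square matrices (of any common dimension) has the finiteness property, then stability is algorithmically decidable for finite sets of nonnegative rational matrices; that is, there is an algorithm which, given as input a finite set $\Sigma$ of $n\times n$ matrices with nonnegative rational entries (for arbitrary $n$), always halts and correctly decides whether $\Sigma$ is stable.
   Context: For a finite nonempty set $\Sigma\subset\mathbb{R}^{n\times n}$ and $t\ge 1$, let $\Sigma^t=\{A_1\cdots A_t : A_i\in\Sigma\}$ be the set of products of length $t$ of matrices from $\Sigma$. The joint spectral radius of $\Sigma$ is $\rho(\Sigma)=\limsup_{t\to\infty}\max\{\|A\|^{1/t}: A\in\Sigma^t\}$, which does not depend on the chosen matrix norm $\|\cdot\|$. For a single matrix $A$, $\rho(A)$ denotes its usual spectral radius. $\Sigma$ has the finiteness property if there exist $t\ge 1$ and a product $A\in\Sigma^t$ such that $\rho(\Sigma)=\rho(A)^{1/t}$. $\Sigma$ is stable if all long products of matrices taken from $\Sigma$ converge to zero; this is equivalent to $\rho(\Sigma)<1$. A binary matrix is a matrix with entries in $\{0,1\}$. *)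

theory Defs
  imports
    "Jordan_Normal_Form.Spectral_Radius"
    "HOL-Library.Nat_Bijection"
    "HOL-Library.Extended_Real"
    "HOL-Library.Liminf_Limsup"
begin

section \<open>Joint spectral radius, finiteness property, stability\<close>

text \<open>The maximum absolute row sum, i.e. the operator norm induced by the supremum norm.
  It is only used for matrices of dimension at least 1, since \<^term>\<open>Max {}\<close> is unspecified.\<close>

definition mat_norm :: "real mat \<Rightarrow> real" where
  "mat_norm A = Max ((\<lambda>i. \<Sum>j<dim_col A. \<bar>A $$ (i, j)\<bar>) ` {..<dim_row A})"

definition mat_prods :: "nat \<Rightarrow> real mat set \<Rightarrow> nat \<Rightarrow> real mat set" where
  "mat_prods n S t = {foldr (*) As (1\<^sub>m n) | As. length As = t \<and> set As \<subseteq> S}"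

text \<open>The value is an extended real because \<^const>\<open>limsup\<close> needs a complete lattice;
  it is finite for finite nonempty sets of matrices of dimension at least 1.
  The term for \<open>t = 0\<close> does not affect the limit superior.\<close>

definition joint_spectral_radius :: "nat \<Rightarrow> real mat set \<Rightarrow> ereal" where
  "joint_spectral_radius n S =
     limsup (\<lambda>t. ereal (Max ((\<lambda>A. root t (mat_norm A)) ` mat_prods n S t)))"

definition finiteness_property :: "nat \<Rightarrow> real mat set \<Rightarrow> bool" where
  "finiteness_property n S \<longleftrightarrow>
     (\<exists>t\<ge>1. \<exists>A\<in>mat_prods n S t.
        joint_spectral_radius n S = ereal (root t (spectral_radius (map_mat complex_of_real A))))"

text \<open>All long products converge to zero: for every \<open>\<epsilon> > 0\<close> there is a length
  from which on every product has norm less than \<open>\<epsilon>\<close>.\<close>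

definition stable :: "nat \<Rightarrow> real mat set \<Rightarrow> bool" where
  "stable n S \<longleftrightarrow> (\<forall>\<epsilon>>0. \<exists>T. \<forall>t\<ge>T. \<forall>A\<in>mat_prods n S t. mat_norm A < \<epsilon>)"

definition binary_mat :: "real mat \<Rightarrow> bool" where
  "binary_mat A \<longleftrightarrow> elements_mat A \<subseteq> {0, 1}"


section \<open>Algorithms: Kleene's partial recursive functions\<close>

datatype recf =
    Zero
  | Succ
  | Proj nat
  | Comp recf "recf list"
  | Prec recf recf
  | Mini recf

text \<open>\<open>computes f xs y\<close>: the computation of \<open>f\<close> on arguments \<open>xs\<close> halts with result \<open>y\<close>.
  Recursion and minimization act on the first argument; the unbounded search \<^const>\<open>Mini\<close>
  halts only if all values before the first zero are defined.\<close>

inductive computes :: "recf \<Rightarrow> nat list \<Rightarrow> nat \<Rightarrow> bool" where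
  zero: "computes Zero xs 0"
| succ: "computes Succ [x] (Suc x)"
| proj: "i < length xs \<Longrightarrow> computes (Proj i) xs (xs ! i)"
| comp: "\<lbrakk>length ys = length gs; \<forall>i<length gs. computes (gs ! i) xs (ys ! i); computes f ys z\<rbrakk>
    \<Longrightarrow> computes (Comp f gs) xs z"
| prec_0: "computes f xs y \<Longrightarrow> computes (Prec f g) (0 # xs) y"
| prec_Suc: "\<lbrakk>computes (Prec f g) (k # xs) r; computes g (k # r # xs) y\<rbrakk>
    \<Longrightarrow> computes (Prec f g) (Suc k # xs) y"
| mini: "\<lbrakk>computes f (y # xs) 0; \<forall>z<y. \<exists>v>0. computes f (z # xs) v\<rbrakk>
    \<Longrightarrow> computes (Mini f) xs y"

inductive_cases computes_ZeroE: "computes Zero xs y"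
inductive_cases computes_SuccE: "computes Succ xs y"
inductive_cases computes_ProjE: "computes (Proj i) xs y"
inductive_cases computes_CompE: "computes (Comp f gs) xs y"
inductive_cases computes_Prec0E: "computes (Prec f g) (0 # xs) y"
inductive_cases computes_PrecSucE: "computes (Prec f g) (Suc k # xs) y"
inductive_cases computes_MiniE: "computes (Mini f) xs y"

lemma computes_deterministic: "computes f xs y \<Longrightarrow> computes f xs y' \<Longrightarrow> y = y'"
proof (induction arbitrary: y' rule: computes.induct)
  case (zero xs)
  then show ?case by (rule computes_ZeroE) simp
next
  case (succ x)
  then show ?case by (rule computes_SuccE) simp
next
  case (proj i xs)
  from proj.prems show ?case by (rule computes_ProjE) simp
next
  case (comp ys gs xs f z)
  from comp.prems obtain ys' where ys': "length ys' = length gs"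
      "\<forall>i<length gs. computes (gs ! i) xs (ys' ! i)" "computes f ys' y'"
    by (rule computes_CompE)
  have "ys = ys'"
    using comp.hyps comp.IH ys' by (intro nth_equalityI) simp_all
  with ys' comp.IH show ?case by simp
next
  case (prec_0 f xs y g)
  from prec_0.prems have "computes f xs y'" by (rule computes_Prec0E)
  then show ?case by (rule prec_0.IH)
next
  case (prec_Suc f g k xs r y)
  from prec_Suc.prems obtain r' where r': "computes (Prec f g) (k # xs) r'"
      "computes g (k # r' # xs) y'"
    by (rule computes_PrecSucE)
  from prec_Suc.IH(1)[OF r'(1)] r'(2) have "computes g (k # r # xs) y'" by simp
  then show ?case by (rule prec_Suc.IH(2))
next
  case (mini f y xs)
  from mini.prems have y'1: "computes f (y' # xs) 0" by (rule computes_MiniE)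
  from mini.prems have y'2: "\<forall>z<y'. \<exists>v>0. computes f (z # xs) v"
    by (rule computes_MiniE)
  have "\<not> y < y'"
  proof
    assume "y < y'"
    with y'2 obtain v where "v > 0" "computes f (y # xs) v" by blast
    with mini.IH(1) show False by fastforce
  qed
  moreover have "\<not> y' < y"
  proof
    assume "y' < y"
    with mini.IH(2) obtain v where "v > 0" "\<And>w. computes f (y' # xs) w \<Longrightarrow> v = w" by blast
    with y'1 show False by fastforce
  qed
  ultimately show ?case by simp
qed

text \<open>The problem with instances \<open>D\<close>, coded as natural numbers by \<open>code\<close>, and question \<open>P\<close>
  is decidable: one program halts on all instances with the right verdict.\<close>

definition decidable_problem :: "('a \<Rightarrow> nat) \<Rightarrow> 'a set \<Rightarrow> ('a \<Rightarrow> bool) \<Rightarrow> bool" where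
  "decidable_problem code D P \<longleftrightarrow>
     (\<exists>f. \<forall>x\<in>D. computes f [code x] (if P x then 1 else 0))"


section \<open>Instances of the stability problem\<close>

text \<open>A finite set of matrices is presented by its dimension and any list enumerating its
  elements, in any order and possibly with repetitions. A nonnegative rational is coded by
  numerator and denominator of its reduced fraction.\<close>

definition code_rat :: "rat \<Rightarrow> nat" where
  "code_rat r = (case quotient_of r of (p, q) \<Rightarrow> prod_encode (nat p, nat q))"

definition code_mat :: "rat mat \<Rightarrow> nat" where
  "code_mat A = list_encode (map (\<lambda>row. list_encode (map code_rat row)) (mat_to_list A))"

definition code_instance :: "nat \<times> rat mat list \<Rightarrow> nat" where
  "code_instance = (\<lambda>(n, Ms). prod_encode (n, list_encode (map code_mat Ms)))"

definition nonneg_rational_instances :: "(nat \<times> rat mat list) set" where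
  "nonneg_rational_instances =
     {(n, Ms). n \<ge> 1 \<and> Ms \<noteq> [] \<and>
        (\<forall>A\<in>set Ms. A \<in> carrier_mat n n \<and> elements_mat A \<subseteq> {0..})}"

definition stable_instance :: "nat \<times> rat mat list \<Rightarrow> bool" where
  "stable_instance = (\<lambda>(n, Ms). stable n (map_mat real_of_rat ` set Ms))"

lemma inj_on_code_rat: "inj_on code_rat {0..}"
proof (rule inj_onI)
  fix r s :: rat
  assume "r \<in> {0..}" "s \<in> {0..}" and eq: "code_rat r = code_rat s"
  then have nn: "r \<ge> 0" "s \<ge> 0" by auto
  obtain p q where r: "quotient_of r = (p, q)" by force
  obtain p' q' where s: "quotient_of s = (p', q')" by force
  have q: "q > 0" "q' > 0" using quotient_of_denom_pos r s by blast+
  have "r = of_int p / of_int q" "s = of_int p' / of_int q'"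
    using quotient_of_div r s by blast+
  with nn q have "p \<ge> 0" "p' \<ge> 0" by (auto simp: zero_le_divide_iff)
  with eq q have "p = p'" "q = q'" by (auto simp: code_rat_def r s)
  then show "r = s" using r s by (metis quotient_of_inject)
qed

end

theory Submission
  imports Defs
begin

text \<open>Stability and instability both have finite certificates made of natural numbers, so an unbounded
  search through all certificates decides. For stability, take a finite set \<open>Y\<close> of positive vectors
  such that every matrix maps every \<open>y \<in> Y\<close> strictly below some \<open>y' \<in> Y\<close>. For instability, take a
  finite set \<open>X\<close> of nonnegative vectors, not all zero, such that every \<open>x \<in> X\<close> satisfies
  \<open>x \<le> A x'\<close> for some matrix \<open>A\<close> and some \<open>x' \<in> X\<close>.

  The certificates are sound for all sets of nonnegative matrices, and stable sets always have one.
  The finiteness property is only needed for the existence of instability certificates: if a product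
  \<open>P\<close> satisfies \<open>x \<le> P x\<close> for a rational \<open>x \<ge> 0\<close>, \<open>x \<noteq> 0\<close>, its partial products applied to \<open>x\<close> form
  such an \<open>X\<close>. If no product has such an \<open>x\<close>, a theorem of alternatives over the rationals gives
  every product \<open>P\<close> a vector \<open>y > 0\<close> with \<open>P y < y\<close>, hence spectral radius less than 1. Encoding the
  matrices, scaled to natural entries by a common denominator \<open>q\<close>, as words of length \<open>L\<close> over a pair
  of binary matrices turns this into \<open>\<rho>(B)\<^sup>L < q\<^sup>t\<close> for every product \<open>B\<close> of length \<open>t\<close> of the pair.
  The finiteness property of the pair then makes the inequality hold for its joint spectral radius,
  and the original set is stable.\<close>

section \<open>Computable functions and predicates\<close>

text \<open>Arguments are passed as an environment of which the program sees the first \<open>k\<close> entries; in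
  the rules that bind a variable, the bound variable is pushed as entry \<open>0\<close>, like a de Bruijn index.\<close>

definition comp_fun :: "nat \<Rightarrow> ((nat \<Rightarrow> nat) \<Rightarrow> nat) \<Rightarrow> bool" where
  "comp_fun k F \<longleftrightarrow> (\<exists>f. \<forall>e. computes f (map e [0..<k]) (F e))"

section \<open>Closure under substitution, primitive recursion and minimization\<close>

lemma map_upt_Suc_conv: "map e [0..<Suc k] = e 0 # map (\<lambda>i. e (Suc i)) [0..<k]"
  by (simp only: map_upt_Suc)

text \<open>Entries \<open>F i\<close> with \<open>i \<ge> m\<close> may be arbitrary, since the
  program for \<open>G\<close> sees only the first \<open>m\<close> entries. This is what lets
  functions of one or two variables be applied inside any environment.\<close>

lemma comp_fun_subst:
  assumes G: "comp_fun m G" and F: "\<And>i. i < m \<Longrightarrow> comp_fun k (F i)"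
  shows "comp_fun k (\<lambda>e. G (\<lambda>i. F i e))"
proof -
  obtain g where g: "\<And>e. computes g (map e [0..<m]) (G e)"
    using G unfolding comp_fun_def by blast
  have "\<forall>i<m. \<exists>f. \<forall>e. computes f (map e [0..<k]) (F i e)"
    using F unfolding comp_fun_def by blast
  then obtain fs where fs: "\<And>i e. i < m \<Longrightarrow> computes (fs i) (map e [0..<k]) (F i e)"
    by metis
  have "computes (Comp g (map fs [0..<m])) (map e [0..<k]) (G (\<lambda>i. F i e))" for e
    by (rule computes.comp[where ys = "map (\<lambda>i. F i e) [0..<m]"]) (auto simp: g fs)
  then show ?thesis unfolding comp_fun_def by blast
qed

lemma comp_fun_var: "i < k \<Longrightarrow> comp_fun k (\<lambda>e. e i)"
  unfolding comp_fun_def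
  by (intro exI[of _ "Proj i"] allI) (use computes.proj[of i "map e [0..<k]" for e] in auto)

lemma comp_fun_app1:
  assumes "comp_fun 1 (\<lambda>e. g (e 0))" "comp_fun k a"
  shows "comp_fun k (\<lambda>e. g (a e))"
  using comp_fun_subst[OF assms(1), of k "\<lambda>_. a"] assms(2) by simp

lemma comp_fun_app2:
  assumes "comp_fun 2 (\<lambda>e. g (e 0) (e 1))" "comp_fun k a" "comp_fun k b"
  shows "comp_fun k (\<lambda>e. g (a e) (b e))"
  using comp_fun_subst[OF assms(1), of k "\<lambda>i. if i = 0 then a else b"] assms(2,3) by simp

lemma comp_fun_Suc: "comp_fun k a \<Longrightarrow> comp_fun k (\<lambda>e. Suc (a e))"
proof (rule comp_fun_app1[where g = Suc])
  show "comp_fun 1 (\<lambda>e. Suc (e 0))"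
    unfolding comp_fun_def by (intro exI[of _ Succ]) (auto intro: computes.succ)
qed

lemma comp_fun_const: "comp_fun k (\<lambda>_. c)"
proof (induction c)
  case 0
  show ?case unfolding comp_fun_def by (intro exI[of _ Zero]) (auto intro: computes.zero)
qed (rule comp_fun_Suc)

text \<open>\<open>Prec\<close> recurses on its first argument, so the counter is at first an
  additional entry 0 of the environment. Substituting \<open>n\<close> for that entry afterwards
  gives the general form.\<close>

lemma comp_fun_rec:
  assumes f: "comp_fun k f" and n: "comp_fun k n"
    and g: "comp_fun (k + 2) (\<lambda>e. g (e 0) (e 1) (\<lambda>i. e (i + 2)))"
  shows "comp_fun k (\<lambda>e. rec_nat (f e) (\<lambda>i r. g i r e) (n e))"
proof -
  obtain pf where pf: "\<And>e. computes pf (map e [0..<k]) (f e)"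
    using f unfolding comp_fun_def by blast
  obtain pg where pg: "\<And>e. computes pg (map e [0..<k + 2]) (g (e 0) (e 1) (\<lambda>i. e (i + 2)))"
    using g unfolding comp_fun_def by blast
  have pg': "computes pg (i # r # map e [0..<k]) (g i r e)" for i r e
    using pg[of "case_nat i (case_nat r e)"] by (simp add: map_upt_Suc_conv del: upt_Suc)
  have "computes (Prec pf pg) (N # map e [0..<k]) (rec_nat (f e) (\<lambda>i r. g i r e) N)" for N e
    by (induction N) (auto intro: computes.prec_0 computes.prec_Suc pf pg')
  then have *: "computes (Prec pf pg) (map e [0..<Suc k])
      (rec_nat (f (\<lambda>i. e (Suc i))) (\<lambda>i r. g i r (\<lambda>i. e (Suc i))) (e 0))" for e
    by (simp only: map_upt_Suc_conv)
  have "comp_fun (Suc k) (\<lambda>e. rec_nat (f (\<lambda>i. e (Suc i))) (\<lambda>i r. g i r (\<lambda>i. e (Suc i))) (e 0))"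
    unfolding comp_fun_def using * by blast
  moreover have "comp_fun k (case i of 0 \<Rightarrow> n | Suc j \<Rightarrow> (\<lambda>e. e j))" if "i < Suc k" for i
    using that n by (cases i) (auto intro: comp_fun_var)
  ultimately show ?thesis
    using comp_fun_subst[of "Suc k" "\<lambda>e. rec_nat (f (\<lambda>i. e (Suc i)))
      (\<lambda>i r. g i r (\<lambda>i. e (Suc i))) (e 0)" k "case_nat n (\<lambda>i e. e i)"] by simp
qed

text \<open>The zero has to exist in every environment because \<open>comp_fun\<close> speaks of
  total functions only.\<close>

lemma comp_fun_Least:
  assumes g: "comp_fun (Suc k) (\<lambda>e. g (e 0) (\<lambda>i. e (Suc i)))" and ex: "\<And>e. \<exists>y. g y e = 0"
  shows "comp_fun k (\<lambda>e. LEAST y. g y e = (0::nat))"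
proof -
  obtain pg where pg: "\<And>e. computes pg (map e [0..<Suc k]) (g (e 0) (\<lambda>i. e (Suc i)))"
    using g unfolding comp_fun_def by blast
  have pg': "computes pg (y # map e [0..<k]) (g y e)" for y e
    using pg[of "case_nat y e"] by (simp add: map_upt_Suc_conv del: upt_Suc)
  have "computes (Mini pg) (map e [0..<k]) (LEAST y. g y e = 0)" for e
  proof (rule computes.mini)
    show "computes pg ((LEAST y. g y e = 0) # map e [0..<k]) 0"
      using pg'[of "LEAST y. g y e = 0" e] LeastI_ex[OF ex[of e]] by simp
    show "\<forall>z<LEAST y. g y e = 0. \<exists>v>0. computes pg (z # map e [0..<k]) v"
    proof (intro allI impI exI conjI)
      fix z assume "z < (LEAST y. g y e = 0)"
      then show "g z e > 0" using not_less_Least by blast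
    qed (rule pg')
  qed
  then show ?thesis unfolding comp_fun_def by blast
qed

section \<open>Arithmetic on natural numbers\<close>

lemma comp_fun_add:
  assumes "comp_fun k a" "comp_fun k b"
  shows "comp_fun k (\<lambda>e. a e + b e)"
proof -
  have "rec_nat x (\<lambda>_. Suc) y = x + y" for x y :: nat
    by (induction y) auto
  moreover have "comp_fun k (\<lambda>e. rec_nat (a e) (\<lambda>_. Suc) (b e))"
    by (intro comp_fun_rec comp_fun_Suc comp_fun_var assms) simp
  ultimately show ?thesis by simp
qed

lemma comp_fun_mult:
  assumes "comp_fun k a" "comp_fun k b"
  shows "comp_fun k (\<lambda>e. a e * b e)"
proof -
  have "comp_fun 2 (\<lambda>e. rec_nat 0 (\<lambda>_ r. r + e 0) (e 1))"
    by (intro comp_fun_rec comp_fun_add comp_fun_const comp_fun_var) simp_all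
  moreover have "rec_nat 0 (\<lambda>_ r. r + x) y = x * y" for x y :: nat
    by (induction y) auto
  ultimately have "comp_fun 2 (\<lambda>e. e 0 * e 1)" by simp
  from comp_fun_app2[OF this assms] show ?thesis .
qed

text \<open>Truncated subtraction iterates the predecessor, which is itself a recursion that ignores
  the previous value and returns the counter.\<close>

lemma comp_fun_diff:
  assumes "comp_fun k a" "comp_fun k b"
  shows "comp_fun k (\<lambda>e. a e - b e)"
proof -
  have "comp_fun 1 (\<lambda>e. rec_nat 0 (\<lambda>i r. i) (e 0))"
    by (intro comp_fun_rec comp_fun_const comp_fun_var) simp_all
  moreover have "rec_nat 0 (\<lambda>i r. i) y = y - 1" for y :: nat
    by (cases y) auto
  ultimately have "comp_fun 1 (\<lambda>e. e 0 - 1)" by simp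
  note pred = comp_fun_app1[OF this]
  have "rec_nat x (\<lambda>_ r. r - 1) y = x - y" for x y :: nat
    by (induction y) auto
  moreover have "comp_fun k (\<lambda>e. rec_nat (a e) (\<lambda>_ r. r - 1) (b e))"
    by (intro comp_fun_rec pred comp_fun_var assms) simp
  ultimately show ?thesis by simp
qed

lemma comp_fun_sum:
  assumes "comp_fun k n" "comp_fun (k + 1) (\<lambda>e. g (e 0) (\<lambda>i. e (i + 1)))"
  shows "comp_fun k (\<lambda>e. \<Sum>i<n e. g i e)"
proof -
  have *: "rec_nat 0 (\<lambda>i r. r + f i) m = (\<Sum>i<m. f i)" for m and f :: "nat \<Rightarrow> nat"
    by (induction m) auto
  have "comp_fun (k + 2) (\<lambda>e. g (e 0) (\<lambda>i. e (i + 2)))"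
    using comp_fun_subst[OF assms(2), of "k + 2" "\<lambda>i e. e (if i = 0 then 0 else i + 1)"]
    by (simp add: comp_fun_var)
  then have "comp_fun k (\<lambda>e. rec_nat 0 (\<lambda>i r. r + g i e) (n e))"
    by (intro comp_fun_rec comp_fun_add comp_fun_const comp_fun_var assms(1)) simp_all
  then show ?thesis unfolding * .
qed

section \<open>Decidable predicates and bounded quantifiers\<close>

definition comp_pred :: "nat \<Rightarrow> ((nat \<Rightarrow> nat) \<Rightarrow> bool) \<Rightarrow> bool" where
  "comp_pred k P \<longleftrightarrow> comp_fun k (\<lambda>e. of_bool (P e))"

lemma comp_pred_le:
  assumes "comp_fun k a" "comp_fun k b"
  shows "comp_pred k (\<lambda>e. a e \<le> b e)"
proof -
  have "comp_fun k (\<lambda>e. 1 - (a e - b e))"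
    by (intro comp_fun_diff comp_fun_const assms)
  moreover have "1 - (x - y) = of_bool (x \<le> y)" for x y :: nat by simp
  ultimately show ?thesis unfolding comp_pred_def by simp
qed

lemma comp_pred_conj:
  assumes "comp_pred k P" "comp_pred k Q"
  shows "comp_pred k (\<lambda>e. P e \<and> Q e)"
  using comp_fun_mult[OF assms[unfolded comp_pred_def]]
  unfolding comp_pred_def of_bool_conj .

lemma comp_pred_not:
  assumes "comp_pred k P"
  shows "comp_pred k (\<lambda>e. \<not> P e)"
proof -
  have "comp_fun k (\<lambda>e. 1 - of_bool (P e))"
    using assms unfolding comp_pred_def by (intro comp_fun_diff comp_fun_const)
  moreover have "1 - of_bool b = (of_bool (\<not> b) :: nat)" for b by simp
  ultimately show ?thesis unfolding comp_pred_def by simp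
qed

lemma comp_pred_imp:
  assumes "comp_pred k P" "comp_pred k Q"
  shows "comp_pred k (\<lambda>e. P e \<longrightarrow> Q e)"
  using comp_pred_not[OF comp_pred_conj[OF assms(1) comp_pred_not[OF assms(2)]]] by simp

lemma comp_pred_less:
  assumes "comp_fun k a" "comp_fun k b"
  shows "comp_pred k (\<lambda>e. a e < b e)"
  using comp_pred_le[OF comp_fun_Suc[OF assms(1)] assms(2)] by (simp add: Suc_le_eq)

lemma comp_pred_eq:
  assumes "comp_fun k a" "comp_fun k b"
  shows "comp_pred k (\<lambda>e. a e = b e)"
  using comp_pred_conj[OF comp_pred_le[OF assms] comp_pred_le[OF assms(2,1)]]
  by (simp add: eq_iff)

text \<open>A bounded universal statement holds iff its number of counterexamples, a finite sum of
  truth values, is 0.\<close>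

lemma comp_pred_all:
  assumes "comp_fun k n" "comp_pred (k + 1) (\<lambda>e. P (e 0) (\<lambda>i. e (i + 1)))"
  shows "comp_pred k (\<lambda>e. \<forall>i<n e. P i e)"
proof -
  have "comp_pred k (\<lambda>e. (\<Sum>i<n e. of_bool (\<not> P i e)) = (0::nat))"
    using comp_pred_not[OF assms(2)] unfolding comp_pred_def[of "k + 1"]
    by (intro comp_pred_eq comp_fun_sum comp_fun_const assms(1))
  then show ?thesis by (simp add: Ball_def del: sum_of_bool_eq)
qed

lemma comp_pred_ex:
  assumes "comp_fun k n" "comp_pred (k + 1) (\<lambda>e. P (e 0) (\<lambda>i. e (i + 1)))"
  shows "comp_pred k (\<lambda>e. \<exists>i<n e. P i e)"
  using comp_pred_not[OF comp_pred_all[OF assms(1) comp_pred_not[OF assms(2)]]]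
  by simp

section \<open>Decoding of pairs and lists\<close>

definition code_fst :: "nat \<Rightarrow> nat" where "code_fst c = fst (prod_decode c)"
definition code_snd :: "nat \<Rightarrow> nat" where "code_snd c = snd (prod_decode c)"

text \<open>The form of search that inverts the pairing function: the wanted component is found by
  minimization, the other one is hidden behind a bounded quantifier.\<close>

lemma comp_fun_Least_ex:
  assumes "comp_pred (k + 2) (\<lambda>e. Q (e 0) (e 1) (\<lambda>i. e (i + 2)))" "comp_fun k n"
    and "\<And>e. \<exists>a. \<exists>b<n e. Q b a e"
  shows "comp_fun k (\<lambda>e. LEAST a. \<exists>b<n e. Q b a e)"
proof -
  have n: "comp_fun (Suc k) (\<lambda>e. n (\<lambda>i. e (Suc i)))"
    using comp_fun_subst[OF assms(2), of "Suc k" "\<lambda>i e. e (Suc i)"] by (auto intro: comp_fun_var)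
  have "comp_pred (Suc k) (\<lambda>e. \<not> (\<exists>b<n (\<lambda>i. e (Suc i)). Q b (e 0) (\<lambda>i. e (Suc i))))"
    using n assms(1) by (intro comp_pred_not comp_pred_ex) auto
  then have "comp_fun k (\<lambda>e. LEAST a. of_bool (\<not> (\<exists>b<n e. Q b a e)) = (0::nat))"
    unfolding comp_pred_def using assms(3) by (intro comp_fun_Least) auto
  then show ?thesis by simp
qed

text \<open>Doubling removes the division by 2 in the triangular number, so that the graph of the
  pairing function becomes a polynomial equation.\<close>

lemma prod_encode_eq_iff: "prod_encode (a, b) = c \<longleftrightarrow> (a + b) * Suc (a + b) + 2 * a = 2 * c"
proof -
  have "2 * triangle m = m * Suc m" for m by (simp add: triangle_def)
  from this[of "a + b"] show ?thesis by (auto simp: prod_encode_def)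
qed

text \<open>The pairing function dominates its arguments, so the other component can be sought below
  \<open>Suc c\<close>; injectivity makes the least solution the only one.\<close>

lemma comp_fun_code_fst: "comp_fun k a \<Longrightarrow> comp_fun k (\<lambda>e. code_fst (a e))"
proof (rule comp_fun_app1[where g = code_fst])
  have *: "prod_decode c = (x, y) \<longleftrightarrow> prod_encode (x, y) = c" for c x y
    by (metis prod_decode_inverse prod_encode_inverse)
  have ex: "\<exists>b<Suc c. prod_encode (code_fst c, b) = c" for c
    by (rule exI[of _ "code_snd c"])
      (metis * code_fst_def code_snd_def le_imp_less_Suc le_prod_encode_2 prod.collapse)
  have "code_fst c = (LEAST a. \<exists>b<Suc c. prod_encode (a, b) = c)" for c
    by (rule Least_equality[symmetric]) (use ex[of c] in \<open>auto simp: code_fst_def\<close>)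
  moreover have "comp_fun 1 (\<lambda>e. LEAST a. \<exists>b<Suc (e 0). prod_encode (a, b) = e 0)"
  proof (rule comp_fun_Least_ex)
    show "comp_pred (1 + 2) (\<lambda>e. prod_encode (e 1, e 0) = e (0 + 2))"
      unfolding prod_encode_eq_iff
      by (intro comp_pred_eq comp_fun_add comp_fun_mult comp_fun_Suc comp_fun_var comp_fun_const) auto
    show "comp_fun 1 (\<lambda>e. Suc (e 0))" by (intro comp_fun_Suc comp_fun_var) simp
    show "\<exists>a. \<exists>b<Suc (e 0). prod_encode (a, b) = e 0" for e by (rule exI, rule ex)
  qed
  ultimately show "comp_fun 1 (\<lambda>e. code_fst (e 0))" by simp
qed

lemma comp_fun_code_snd: "comp_fun k a \<Longrightarrow> comp_fun k (\<lambda>e. code_snd (a e))"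
proof (rule comp_fun_app1[where g = code_snd])
  have *: "prod_decode c = (x, y) \<longleftrightarrow> prod_encode (x, y) = c" for c x y
    by (metis prod_decode_inverse prod_encode_inverse)
  have ex: "\<exists>b<Suc c. prod_encode (b, code_snd c) = c" for c
    by (rule exI[of _ "code_fst c"])
      (metis * code_fst_def code_snd_def le_imp_less_Suc le_prod_encode_1 prod.collapse)
  have "code_snd c = (LEAST a. \<exists>b<Suc c. prod_encode (b, a) = c)" for c
    by (rule Least_equality[symmetric]) (use ex[of c] in \<open>auto simp: code_snd_def\<close>)
  moreover have "comp_fun 1 (\<lambda>e. LEAST a. \<exists>b<Suc (e 0). prod_encode (b, a) = e 0)"
  proof (rule comp_fun_Least_ex)
    show "comp_pred (1 + 2) (\<lambda>e. prod_encode (e 0, e 1) = e (0 + 2))"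
      unfolding prod_encode_eq_iff
      by (intro comp_pred_eq comp_fun_add comp_fun_mult comp_fun_Suc comp_fun_var comp_fun_const) auto
    show "comp_fun 1 (\<lambda>e. Suc (e 0))" by (intro comp_fun_Suc comp_fun_var) simp
    show "\<exists>a. \<exists>b<Suc (e 0). prod_encode (b, a) = e 0" for e by (rule exI, rule ex)
  qed
  ultimately show "comp_fun 1 (\<lambda>e. code_snd (e 0))" by simp
qed

text \<open>\<open>list_encode\<close> codes a nonempty list as the successor of a pair of head and
  coded tail; \<open>r - 1\<close> undoes the successor. The empty list has code 0, which is a fixed
  point because 0 also codes the pair of zeros.\<close>

definition code_drop :: "nat \<Rightarrow> nat \<Rightarrow> nat" where
  "code_drop l i = rec_nat l (\<lambda>_ r. code_snd (r - 1)) i"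

definition code_nth :: "nat \<Rightarrow> nat \<Rightarrow> nat" where
  "code_nth l i = code_fst (code_drop l i - 1)"

lemma code_drop_list_encode: "code_drop (list_encode xs) i = list_encode (drop i xs)"
proof (induction i)
  case (Suc i)
  have 0: "prod_decode 0 = (0, 0)"
    using prod_encode_inverse[of "(0, 0)"] by (simp add: prod_encode_def)
  have "code_snd (list_encode ys - 1) = list_encode (tl ys)" for ys
    by (cases ys) (auto simp: code_snd_def 0)
  with Suc show ?case by (simp add: code_drop_def tl_drop drop_Suc)
qed (simp add: code_drop_def)

lemma code_nth_list_encode: "i < length xs \<Longrightarrow> code_nth (list_encode xs) i = xs ! i"
  by (simp add: code_nth_def code_drop_list_encode code_fst_def flip: Cons_nth_drop_Suc)

lemma comp_fun_code_drop: "comp_fun k a \<Longrightarrow> comp_fun k b \<Longrightarrow> comp_fun k (\<lambda>e. code_drop (a e) (b e))"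
  unfolding code_drop_def
  by (intro comp_fun_rec comp_fun_code_snd comp_fun_diff comp_fun_const comp_fun_var) simp_all

lemma comp_fun_code_nth: "comp_fun k a \<Longrightarrow> comp_fun k b \<Longrightarrow> comp_fun k (\<lambda>e. code_nth (a e) (b e))"
  unfolding code_nth_def
  by (intro comp_fun_code_fst comp_fun_diff comp_fun_const comp_fun_code_drop)

text \<open>Minimization halts at the least \<open>w\<close> that passes one of the two checks. A
  witness of one kind rules out all witnesses of the other, so evaluating \<open>Y\<close> at this
  \<open>w\<close> yields the verdict.\<close>

lemma decidable_problem_by_witnesses:
  assumes Yes: "comp_pred 2 (\<lambda>e. Y (e 0) (e 1))" and No: "comp_pred 2 (\<lambda>e. N (e 0) (e 1))"
    and "\<And>x. x \<in> D \<Longrightarrow> P x \<longleftrightarrow> (\<exists>w. Y w (code x))"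
    and "\<And>x. x \<in> D \<Longrightarrow> \<not> P x \<longleftrightarrow> (\<exists>w. N w (code x))"
  shows "decidable_problem code D P"
proof -
  obtain f where f: "\<And>e. computes f (map e [0..<2]) (of_bool (Y (e 0) (e 1)))"
    using Yes unfolding comp_pred_def comp_fun_def by blast
  have f: "computes f [w, c] (of_bool (Y w c))" for w c
    using f[of "case_nat w (\<lambda>_. c)"] by (simp add: upt_rec)
  have "comp_pred 2 (\<lambda>e. \<not> Y (e 0) (e 1) \<and> \<not> N (e 0) (e 1))"
    by (intro comp_pred_conj comp_pred_not Yes No)
  then obtain g where g: "\<And>e. computes g (map e [0..<2])
      (of_bool (\<not> Y (e 0) (e 1) \<and> \<not> N (e 0) (e 1)))"
    unfolding comp_pred_def comp_fun_def by blast
  have g: "computes g [w, c] (of_bool (\<not> Y w c \<and> \<not> N w c))" for w c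
    using g[of "case_nat w (\<lambda>_. c)"] by (simp add: upt_rec)
  show ?thesis
    unfolding decidable_problem_def
  proof (intro exI ballI)
    fix x assume x: "x \<in> D"
    define w where "w = (LEAST w. Y w (code x) \<or> N w (code x))"
    have ex: "\<exists>w. Y w (code x) \<or> N w (code x)" using assms(3,4)[OF x] by blast
    have w: "Y w (code x) \<or> N w (code x)" unfolding w_def by (rule LeastI_ex[OF ex])
    have verdict: "of_bool (Y w (code x)) = (if P x then 1 else 0 :: nat)"
      using w assms(3,4)[OF x] by auto
    have "computes (Mini g) [code x] w"
    proof (rule computes.mini)
      show "computes g (w # [code x]) 0" using g[of w "code x"] w by auto
      show "\<forall>z<w. \<exists>v>0. computes g (z # [code x]) v"
      proof (intro allI impI)
        fix z assume "z < w"
        then have "\<not> (Y z (code x) \<or> N z (code x))" unfolding w_def by (rule not_less_Least)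
        then show "\<exists>v>0. computes g (z # [code x]) v" using g[of z "code x"] by auto
      qed
    qed
    moreover have "computes (Proj 0) [code x] (code x)"
      using computes.proj[of 0 "[code x]"] by simp
    ultimately show "computes (Comp f [Mini g, Proj 0]) [code x] (if P x then 1 else 0)"
      using f[of w "code x"] verdict
      by (intro computes.comp[where ys = "[w, code x]"]) (auto simp: less_Suc_eq)
  qed
qed

section \<open>A theorem of alternatives for nonnegative matrices\<close>

text \<open>Induction on the dimension, eliminating the last coordinate by a Schur complement.\<close>

lemma nonneg_matrix_alternative:
  fixes A :: "nat \<Rightarrow> nat \<Rightarrow> 'a::linordered_field"
  assumes "\<forall>i<n. \<forall>j<n. A i j \<ge> 0"
  shows "(\<exists>x. (\<forall>i<n. x i \<ge> 0) \<and> (\<exists>i<n. x i > 0) \<and> (\<forall>i<n. x i \<le> (\<Sum>j<n. A i j * x j))) \<or>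
         (\<exists>y. (\<forall>i<n. y i > 0) \<and> (\<forall>i<n. (\<Sum>j<n. A i j * y j) < y i))"
  using assms
proof (induction n arbitrary: A)
  case (Suc n)
  note A0 = Suc.prems[rule_format]
  define d where "d = A n n"
  show ?case
  proof (cases "d \<ge> 1")
    case True
    \<comment> \<open>The last unit vector already satisfies \<open>x \<le> A x\<close>, since the
      diagonal entry is at least 1 and the rest of its column is nonnegative.\<close>
    define x where "x = (\<lambda>i. if i = n then 1 else 0 :: 'a)"
    have "(\<Sum>j<Suc n. A i j * x j) = A i n" for i
      by (simp add: x_def)
    then have "\<forall>i<Suc n. x i \<le> (\<Sum>j<Suc n. A i j * x j)"
      using True A0 by (auto simp: x_def d_def)
    then show ?thesis by (intro disjI1 exI[of _ x]) (auto simp: x_def)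
  next
    case False
    then have d: "1 - d > 0" by simp
    \<comment> \<open>Solving row \<open>n\<close> of \<open>z = A z\<close> for the last coordinate
      gives \<open>(\<Sum>j<n. A n j * z j) / (1 - d)\<close>; inserting this into the other rows
      turns \<open>A\<close> into \<open>B\<close>.\<close>
    define B where "B i j = A i j + A i n * A n j / (1 - d)" for i j
    have B0: "\<forall>i<n. \<forall>j<n. B i j \<ge> 0"
      unfolding B_def using d A0
      by (intro allI impI add_nonneg_nonneg divide_nonneg_pos mult_nonneg_nonneg) auto
    have B_sum: "(\<Sum>j<n. B i j * z j) = (\<Sum>j<n. A i j * z j) + A i n * ((\<Sum>j<n. A n j * z j) / (1 - d))"
      for i and z :: "nat \<Rightarrow> 'a"
      unfolding B_def by (simp add: algebra_simps sum.distrib sum_divide_distrib sum_distrib_left)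
    from Suc.IH[of B, OF B0] consider
        (X) x where "\<forall>i<n. x i \<ge> 0" "\<exists>i<n. x i > 0" "\<forall>i<n. x i \<le> (\<Sum>j<n. B i j * x j)"
      | (Y) y where "\<forall>i<n. y i > 0" "\<forall>i<n. (\<Sum>j<n. B i j * y j) < y i"
      by blast
    then show ?thesis
    proof cases
      case X
      note x = X
      define s where "s = (\<Sum>j<n. A n j * x j) / (1 - d)"
      have s: "s \<ge> 0" unfolding s_def using d A0 x(1)
        by (intro divide_nonneg_pos sum_nonneg mult_nonneg_nonneg) auto
      define x' where "x' = x(n := s)"
      have sum: "(\<Sum>j<Suc n. A i j * x' j) = (\<Sum>j<n. A i j * x j) + A i n * s" for i
        by (simp add: x'_def)
      have "x' i \<le> (\<Sum>j<Suc n. A i j * x' j)" if "i < Suc n" for i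
      proof (cases "i = n")
        case True
        have "(\<Sum>j<n. A n j * x j) = (1 - d) * s" using d by (simp add: s_def)
        then show ?thesis unfolding sum True by (simp add: x'_def d_def algebra_simps)
      next
        case False
        then show ?thesis unfolding sum using x(3)[rule_format, of i] that B_sum[of i x] by (simp add: x'_def s_def)
      qed
      moreover have "\<forall>i<Suc n. x' i \<ge> 0" using x(1) s by (auto simp: x'_def)
      moreover have "\<exists>i<Suc n. x' i > 0" using x(2) by (auto simp: x'_def less_Suc_eq)
      ultimately show ?thesis by blast
    next
      case Y
      note y = Y
      define s where "s = (\<Sum>j<n. A n j * y j) / (1 - d)"
      have s: "s \<ge> 0" unfolding s_def using d A0 y(1)
        by (intro divide_nonneg_pos sum_nonneg mult_nonneg_nonneg) (auto intro: less_imp_le)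
      \<comment> \<open>In the last row the solved value \<open>s\<close> only gives equality, so it
        is raised by a small \<open>\<epsilon>\<close>. Row \<open>i\<close> then grows by
        \<open>A i n * \<epsilon>\<close>, which stays below its slack if
        \<open>\<epsilon> \<le> g i\<close>; the summand 1 keeps the denominator positive.\<close>
      define g where "g i = (y i - (\<Sum>j<n. B i j * y j)) / (A i n + 1)" for i
      define \<epsilon> where "\<epsilon> = Min (insert 1 (g ` {..<n}))"
      have g: "g i > 0" if "i < n" for i
        unfolding g_def using y(2) that A0[of i n] by (intro divide_pos_pos) auto
      then have \<epsilon>: "\<epsilon> > 0" unfolding \<epsilon>_def by (subst Min_gr_iff) auto
      define y' where "y' = y(n := s + \<epsilon>)"
      have sum: "(\<Sum>j<Suc n. A i j * y' j) = (\<Sum>j<n. A i j * y j) + A i n * (s + \<epsilon>)" for i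
        by (simp add: y'_def)
      have "(\<Sum>j<Suc n. A i j * y' j) < y' i" if "i < Suc n" for i
      proof (cases "i = n")
        case True
        have "(\<Sum>j<n. A n j * y j) = (1 - d) * s" using d by (simp add: s_def)
        moreover have "d * \<epsilon> < \<epsilon>" using d \<epsilon> by simp
        ultimately show ?thesis unfolding sum True by (simp add: y'_def d_def algebra_simps)
      next
        case False
        with that have i: "i < n" by simp
        have An: "A i n \<ge> 0" using A0[of i n] i by simp
        have "\<epsilon> \<le> g i" unfolding \<epsilon>_def using i by (intro Min_le) auto
        then have "A i n * \<epsilon> \<le> A i n * g i" using An by (rule mult_left_mono)
        also have "\<dots> < (A i n + 1) * g i" using g[OF i] by (simp add: algebra_simps)
        also have "\<dots> = y i - (\<Sum>j<n. B i j * y j)" using An by (simp add: g_def)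
        finally show ?thesis unfolding sum using B_sum[of i y] i
          by (simp add: y'_def s_def algebra_simps)
      qed
      moreover have "\<forall>i<Suc n. y' i > 0" using y(1) s \<epsilon> by (auto simp: y'_def)
      ultimately show ?thesis by blast
    qed
  qed
qed auto

section \<open>Products of matrices acting on vectors\<close>

text \<open>Vectors take values in any real vector space, so that the same action serves real bounds
  and complex eigenvectors.\<close>

definition mv :: "nat \<Rightarrow> real mat \<Rightarrow> (nat \<Rightarrow> 'b) \<Rightarrow> nat \<Rightarrow> 'b::real_vector" where
  "mv n A v = (\<lambda>i. \<Sum>j<n. A $$ (i, j) *\<^sub>R v j)"

definition act :: "nat \<Rightarrow> real mat list \<Rightarrow> (nat \<Rightarrow> 'b) \<Rightarrow> nat \<Rightarrow> 'b::real_vector" where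
  "act n As v = foldr (mv n) As v"

lemma act_Nil [simp]: "act n [] v = v" by (simp add: act_def)
lemma act_Cons [simp]: "act n (A # As) v = mv n A (act n As v)" by (simp add: act_def)

lemma foldr_mat_carrier:
  "set As \<subseteq> carrier_mat n n \<Longrightarrow> foldr (*) As (1\<^sub>m n) \<in> carrier_mat n n"
  by (induction As) auto

lemma mv_foldr:
  assumes "set As \<subseteq> carrier_mat n n" "i < n"
  shows "mv n (foldr (*) As (1\<^sub>m n)) v i = act n As v i"
  using assms
proof (induction As arbitrary: i)
  case Nil
  have "(1\<^sub>m n :: real mat) $$ (i, j) *\<^sub>R v j = (if i = j then v j else 0)" if "j < n" for j
    using Nil.prems that by auto
  then have "(\<Sum>j<n. (1\<^sub>m n :: real mat) $$ (i, j) *\<^sub>R v j) = (\<Sum>j<n. if i = j then v j else 0)"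
    by (intro sum.cong) auto
  with Nil.prems show ?case by (simp add: mv_def)
next
  case (Cons A As)
  define P where "P = foldr (*) As (1\<^sub>m n)"
  have P: "P \<in> carrier_mat n n" and A: "A \<in> carrier_mat n n"
    using Cons.prems foldr_mat_carrier[of As n] by (auto simp: P_def)
  have "mv n (A * P) v i = (\<Sum>j<n. (\<Sum>k<n. A $$ (i, k) * P $$ (k, j)) *\<^sub>R v j)"
    unfolding mv_def using P A Cons.prems
    by (intro sum.cong) (auto simp: scalar_prod_def atLeast0LessThan)
  also have "\<dots> = (\<Sum>k<n. A $$ (i, k) *\<^sub>R (\<Sum>j<n. P $$ (k, j) *\<^sub>R v j))"
    by (simp add: scaleR_sum_left scaleR_sum_right) (rule sum.swap)
  also have "\<dots> = (\<Sum>k<n. A $$ (i, k) *\<^sub>R act n As v k)"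
    using Cons by (intro sum.cong) (auto simp: mv_def P_def)
  finally show ?case by (simp add: P_def mv_def)
qed

lemma mv_nonneg:
  fixes v :: "nat \<Rightarrow> real"
  assumes "\<forall>j<n. 0 \<le> A $$ (i, j)" "\<forall>j<n. 0 \<le> v j"
  shows "0 \<le> mv n A v i"
  unfolding mv_def using assms by (intro sum_nonneg) auto

lemma mv_mono:
  fixes v w :: "nat \<Rightarrow> real"
  assumes "\<forall>j<n. 0 \<le> A $$ (i, j)" "\<forall>j<n. v j \<le> w j"
  shows "mv n A v i \<le> mv n A w i"
  unfolding mv_def using assms by (intro sum_mono) (auto intro: mult_left_mono)

lemma mv_scale:
  fixes v :: "nat \<Rightarrow> real"
  shows "mv n A (\<lambda>j. c * v j) = (\<lambda>i. c * mv n A v i)"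
  by (simp add: mv_def sum_distrib_left algebra_simps)

definition nonneg_mats :: "nat \<Rightarrow> real mat set" where
  "nonneg_mats n = {A \<in> carrier_mat n n. \<forall>i<n. \<forall>j<n. 0 \<le> A $$ (i, j)}"

lemma foldr_mat_nonneg:
  assumes "set As \<subseteq> nonneg_mats n" "i < n" "j < n"
  shows "0 \<le> (foldr (*) As (1\<^sub>m n) :: real mat) $$ (i, j)"
  using assms
proof (induction As arbitrary: i j)
  case (Cons A As)
  have "set As \<subseteq> carrier_mat n n" using Cons.prems by (auto simp: nonneg_mats_def)
  note foldr_mat_carrier[OF this]
  with Cons show ?case
    by (auto simp: nonneg_mats_def scalar_prod_def intro!: sum_nonneg mult_nonneg_nonneg)
qed auto

text \<open>Without signs, the absolute row sums of the product are the coordinates of its value at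
  the all-ones vector.\<close>

lemma mat_norm_eq_act:
  assumes As: "set As \<subseteq> nonneg_mats n"
  shows "mat_norm (foldr (*) As (1\<^sub>m n)) = Max (act n As (\<lambda>_. 1) ` {..<n})"
proof -
  have C: "set As \<subseteq> carrier_mat n n" using As by (auto simp: nonneg_mats_def)
  define P where "P = foldr (*) As (1\<^sub>m n)"
  have P: "P \<in> carrier_mat n n" using foldr_mat_carrier[OF C] by (simp add: P_def)
  have "(\<Sum>j<n. \<bar>P $$ (i, j)\<bar>) = act n As (\<lambda>_. 1) i" if "i < n" for i
    using mv_foldr[OF C that, of "\<lambda>_. 1 :: real"] foldr_mat_nonneg[OF As that]
    by (simp add: mv_def P_def)
  then show ?thesis using P unfolding mat_norm_def P_def[symmetric]
    by (intro arg_cong[of _ _ Max] image_cong) auto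
qed

lemma stable_iff_act:
  assumes S: "S \<subseteq> nonneg_mats n" and n: "n \<ge> 1"
  shows "stable n S \<longleftrightarrow>
    (\<forall>\<epsilon>>0. \<exists>T. \<forall>As. T \<le> length As \<longrightarrow> set As \<subseteq> S \<longrightarrow> (\<forall>i<n. act n As (\<lambda>_. 1) i < (\<epsilon>::real)))"
proof -
  have *: "mat_norm (foldr (*) As (1\<^sub>m n)) < \<epsilon> \<longleftrightarrow> (\<forall>i<n. act n As (\<lambda>_. 1) i < \<epsilon>)"
    if "set As \<subseteq> S" for As \<epsilon>
  proof -
    have "set As \<subseteq> nonneg_mats n" using that S by blast
    from mat_norm_eq_act[OF this] show ?thesis using n by (auto simp: lessThan_empty_iff)
  qed
  have "(\<forall>t\<ge>T. \<forall>A\<in>mat_prods n S t. mat_norm A < \<epsilon>) \<longleftrightarrow>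
      (\<forall>As. T \<le> length As \<longrightarrow> set As \<subseteq> S \<longrightarrow> mat_norm (foldr (*) As (1\<^sub>m n)) < \<epsilon>)" for T \<epsilon>
    unfolding mat_prods_def by blast
  then show ?thesis unfolding stable_def using * by simp
qed

lemma act_nonneg:
  fixes v :: "nat \<Rightarrow> real"
  assumes "set As \<subseteq> nonneg_mats n" "\<forall>j<n. 0 \<le> v j" "i < n"
  shows "0 \<le> act n As v i"
  using assms(1,3)
proof (induction As arbitrary: i)
  case Nil
  then show ?case using assms(2) by simp
next
  case (Cons A As)
  then show ?case by (auto intro!: mv_nonneg simp: nonneg_mats_def)
qed

lemma act_mono:
  fixes v w :: "nat \<Rightarrow> real"
  assumes "set As \<subseteq> nonneg_mats n" "\<forall>j<n. v j \<le> w j" "i < n"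
  shows "act n As v i \<le> act n As w i"
  using assms(1,3)
proof (induction As arbitrary: i)
  case Nil
  then show ?case using assms(2) by simp
next
  case (Cons A As)
  then show ?case by (auto intro!: mv_mono simp: nonneg_mats_def)
qed

lemma act_scale:
  fixes v :: "nat \<Rightarrow> real"
  shows "act n As (\<lambda>j. c * v j) = (\<lambda>i. c * act n As v i)"
  by (induction As) (simp_all add: mv_scale)

section \<open>Certificates for stability and instability\<close>

text \<open>Since \<open>Y\<close> and \<open>S\<close> are finite, the strict inequalities hold with a common factor \<open>\<theta> < 1\<close>.\<close>

lemma stable_if_contracted_vectors:
  assumes S: "S \<subseteq> nonneg_mats n" "finite S" and n: "n \<ge> 1"
    and Y: "finite Y" "Y \<noteq> {}" "\<And>y i. y \<in> Y \<Longrightarrow> i < n \<Longrightarrow> (0::real) < y i"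
    and contr: "\<And>y A. y \<in> Y \<Longrightarrow> A \<in> S \<Longrightarrow> \<exists>y'\<in>Y. \<forall>i<n. mv n A y i < y' i"
  shows "stable n S"
proof -
  obtain s where s: "\<And>y A. y \<in> Y \<Longrightarrow> A \<in> S \<Longrightarrow> s y A \<in> Y"
      "\<And>y A i. y \<in> Y \<Longrightarrow> A \<in> S \<Longrightarrow> i < n \<Longrightarrow> mv n A y i < s y A i"
    using contr by metis
  define R where "R = (\<lambda>(y, A, i). mv n A y i / s y A i) ` (Y \<times> S \<times> {..<n})"
  have R: "finite R" unfolding R_def using S(2) Y(1) by auto
  \<comment> \<open>The inserted 0 keeps the maximum defined when \<open>S\<close> is empty.\<close>
  define \<theta> where "\<theta> = Max (insert 0 R)"
  have \<theta>: "0 \<le> \<theta>" "\<theta> < 1"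
    unfolding \<theta>_def using R Y s by (auto simp: R_def)
  have step: "mv n A y i \<le> \<theta> * s y A i" if "y \<in> Y" "A \<in> S" "i < n" for y A i
  proof -
    have "mv n A y i / s y A i \<le> \<theta>"
      unfolding \<theta>_def using R that
      by (intro Max_ge) (auto simp: R_def intro!: rev_image_eqI[of "(y, A, i)"])
    then show ?thesis using Y(3)[OF s(1)[OF that(1,2)] that(3)] by (simp add: pos_divide_le_eq)
  qed
  have power: "\<exists>y'\<in>Y. \<forall>i<n. act n As y i \<le> \<theta> ^ length As * y' i"
    if "set As \<subseteq> S" "y \<in> Y" for As y
    using that
  proof (induction As)
    case (Cons A As)
    then obtain y' where y': "y' \<in> Y" "\<forall>i<n. act n As y i \<le> \<theta> ^ length As * y' i" by auto
    have A: "A \<in> S" using Cons.prems by simp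
    have "act n (A # As) y i \<le> \<theta> ^ length (A # As) * s y' A i" if i: "i < n" for i
    proof -
      have "act n (A # As) y i \<le> mv n A (\<lambda>j. \<theta> ^ length As * y' j) i"
        using y'(2) A S(1) i by (auto intro!: mv_mono simp: nonneg_mats_def)
      also have "\<dots> = \<theta> ^ length As * mv n A y' i" by (simp add: mv_scale)
      also have "\<dots> \<le> \<theta> ^ length As * (\<theta> * s y' A i)"
        using step[OF y'(1) A i] \<theta> by (intro mult_left_mono) auto
      finally show ?thesis by (simp add: algebra_simps)
    qed
    then show ?case using s(1)[OF y'(1) A] by blast
  qed auto
  obtain y where y: "y \<in> Y" using Y(2) by blast
  \<comment> \<open>\<open>c\<close> and \<open>C\<close> compare \<open>Y\<close> with the all-ones
    vector: \<open>c\<close> bounds the starting vector \<open>y\<close> from below,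
    \<open>C\<close> bounds all of \<open>Y\<close> from above.\<close>
  define c where "c = Min (y ` {..<n})"
  define C where "C = Max ((\<lambda>(y, i). y i) ` (Y \<times> {..<n}))"
  have ne: "y ` {..<n} \<noteq> {}" using n by (auto simp: lessThan_empty_iff)
  have "c \<in> y ` {..<n}" unfolding c_def using ne by (intro Min_in) auto
  then have c: "c > 0" using Y(3)[OF y] by auto
  have cy: "c \<le> y i" if "i < n" for i unfolding c_def using that by (intro Min_le) auto
  have Cy: "y' i \<le> C" if "y' \<in> Y" "i < n" for y' i
    unfolding C_def using that Y(1) by (intro Max_ge) (auto intro!: rev_image_eqI[of "(y', i)"])
  have C: "C > 0" using Cy[OF y, of 0] Y(3)[OF y, of 0] n by simp
  have bound: "act n As (\<lambda>_. 1) i \<le> \<theta> ^ length As * C / c" if As: "set As \<subseteq> S" and i: "i < n" for As i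
  proof -
    obtain y' where y': "y' \<in> Y" "\<forall>i<n. act n As y i \<le> \<theta> ^ length As * y' i"
      using power[OF As y] by blast
    have "c * act n As (\<lambda>_. 1) i = act n As (\<lambda>j. c * 1) i" by (simp only: act_scale)
    also have "\<dots> \<le> act n As y i" using As S(1) cy i by (intro act_mono) auto
    also have "\<dots> \<le> \<theta> ^ length As * y' i" using y' i by blast
    also have "\<dots> \<le> \<theta> ^ length As * C" using Cy[OF y'(1) i] \<theta> by (intro mult_left_mono) auto
    finally show ?thesis using c by (simp add: pos_le_divide_eq mult.commute)
  qed
  show ?thesis
    unfolding stable_iff_act[OF S(1) n]
  proof (intro allI impI)
    fix \<epsilon> :: real assume \<epsilon>: "\<epsilon> > 0"
    obtain T where T: "\<theta> ^ T < \<epsilon> * c / C"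
      using real_arch_pow_inv[of "\<epsilon> * c / C" \<theta>] \<epsilon> c C \<theta> by auto
    have "act n As (\<lambda>_. 1) i < \<epsilon>" if "T \<le> length As" "set As \<subseteq> S" "i < n" for As i
    proof -
      have "\<theta> ^ length As * C / c \<le> \<theta> ^ T * C / c"
        using \<theta> that c C by (intro divide_right_mono mult_right_mono power_decreasing) auto
      also have "\<dots> < \<epsilon>" using T c C by (simp add: field_simps)
      finally show ?thesis using bound[OF that(2,3)] by simp
    qed
    then show "\<exists>T. \<forall>As. T \<le> length As \<longrightarrow> set As \<subseteq> S \<longrightarrow> (\<forall>i<n. act n As (\<lambda>_. 1) i < \<epsilon>)"
      by blast
  qed
qed

text \<open>Following supports for \<open>t\<close> steps gives a word of length \<open>t\<close>
  whose action on some \<open>x'\<close> in \<open>X\<close> dominates \<open>x\<close>. As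
  \<open>X\<close> is bounded by a constant \<open>C\<close>, the same word applied to the all-ones
  vector is at least \<open>x i / C\<close> at \<open>i\<close>, for every \<open>t\<close>.\<close>

lemma not_stable_if_supported_vectors:
  assumes S: "S \<subseteq> nonneg_mats n" and n: "n \<ge> 1"
    and X: "finite X" and x: "x \<in> X" "i < n" "(0::real) < x i"
    and supp: "\<And>x. x \<in> X \<Longrightarrow> \<exists>A\<in>S. \<exists>x'\<in>X. \<forall>i<n. x i \<le> mv n A x' i"
  shows "\<not> stable n S"
proof
  assume stable: "stable n S"
  have chain: "\<exists>As. length As = t \<and> set As \<subseteq> S \<and> (\<exists>x'\<in>X. \<forall>i<n. x i \<le> act n As x' i)"
    if "x \<in> X" for t x
    using that
  proof (induction t arbitrary: x)
    case 0
    then show ?case by (intro exI[of _ "[]"]) auto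
  next
    case (Suc t)
    obtain A x1 where A: "A \<in> S" "x1 \<in> X" "\<forall>i<n. x i \<le> mv n A x1 i"
      using supp[OF Suc.prems] by blast
    obtain As x' where As: "length As = t" "set As \<subseteq> S" "x' \<in> X" "\<forall>i<n. x1 i \<le> act n As x' i"
      using Suc.IH[OF A(2)] by blast
    have "x i \<le> act n (A # As) x' i" if "i < n" for i
    proof -
      have "x i \<le> mv n A x1 i" using A that by blast
      also have "\<dots> \<le> mv n A (act n As x') i"
        using A(1) S As(4) that by (intro mv_mono) (auto simp: nonneg_mats_def)
      finally show ?thesis by simp
    qed
    with A As show ?case by (intro exI[of _ "A # As"]) auto
  qed
  define C where "C = Max (insert 1 ((\<lambda>(x, i). x i) ` (X \<times> {..<n})))"
  have fin: "finite ((\<lambda>(x, i). x i) ` (X \<times> {..<n}))" using X by auto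
  have C1: "C \<ge> 1" unfolding C_def using fin by (intro Max_ge) auto
  have C: "x' j \<le> C" if "x' \<in> X" "j < n" for x' j
    unfolding C_def using that fin by (intro Max_ge) (auto intro!: rev_image_eqI[of "(x', j)"])
  have "x i / C > 0" using C1 x(3) by simp
  then obtain T where T: "\<And>As j. T \<le> length As \<Longrightarrow> set As \<subseteq> S \<Longrightarrow> j < n \<Longrightarrow>
      act n As (\<lambda>_. 1) j < x i / C"
    using stable unfolding stable_iff_act[OF S n] by meson
  obtain As x' where As: "length As = T" "set As \<subseteq> S" "x' \<in> X" "\<forall>i<n. x i \<le> act n As x' i"
    using chain[OF x(1)] by blast
  have "x i \<le> act n As x' i" using As x(2) by blast
  also have "\<dots> \<le> act n As (\<lambda>_. C * 1) i"
    using As S C x(2) by (intro act_mono) auto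
  also have "\<dots> = C * act n As (\<lambda>_. 1) i" by (simp only: act_scale)
  also have "\<dots> < x i" using T[of As i] As x(2) C1 by (simp add: field_simps)
  finally show False by simp
qed

text \<open>Adding \<open>\<eta>\<close> at every step makes \<open>A y < y'\<close> strict; for words up to a fixed length the
  perturbation stays small.\<close>

definition padded_act :: "nat \<Rightarrow> real \<Rightarrow> real mat list \<Rightarrow> nat \<Rightarrow> real" where
  "padded_act n \<eta> As = foldr (\<lambda>A v i. mv n A v i + \<eta>) As (\<lambda>_. 1)"

lemma padded_act_simps [simp]:
  "padded_act n \<eta> [] = (\<lambda>_. 1)"
  "padded_act n \<eta> (A # As) = (\<lambda>i. mv n A (padded_act n \<eta> As) i + \<eta>)"
  by (simp_all add: padded_act_def)

text \<open>One more letter multiplies the accumulated error by at most the largest row sum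
  \<open>r\<close> in \<open>S\<close> and adds \<open>\<eta>\<close>, whence the recursion from
  \<open>C\<close> to \<open>C * r + 1\<close>. The constant does not depend on
  \<open>\<eta>\<close>, which can therefore be chosen after it.\<close>

lemma padded_act_le:
  assumes S: "S \<subseteq> nonneg_mats n" "finite S"
  shows "\<exists>C\<ge>0. \<forall>As \<eta> i. length As = t \<longrightarrow> set As \<subseteq> S \<longrightarrow> 0 \<le> \<eta> \<longrightarrow> i < n \<longrightarrow>
           padded_act n \<eta> As i \<le> act n As (\<lambda>_. 1) i + \<eta> * C"
proof (induction t)
  case (Suc t)
  then obtain C where C: "C \<ge> 0" "\<And>As \<eta> i. length As = t \<Longrightarrow> set As \<subseteq> S \<Longrightarrow> 0 \<le> \<eta> \<Longrightarrow> i < n \<Longrightarrow>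
           padded_act n \<eta> As i \<le> act n As (\<lambda>_. 1) i + \<eta> * C" by blast
  define r :: real where "r = Max (insert 0 ((\<lambda>(A, i). mv n A (\<lambda>_. 1) i) ` (S \<times> {..<n})))"
  have fin: "finite ((\<lambda>(A, i). mv n A (\<lambda>_. 1::real) i) ` (S \<times> {..<n}))" using S by auto
  have r0: "r \<ge> 0" unfolding r_def using fin by (intro Max_ge) auto
  have r: "mv n A (\<lambda>_. 1) i \<le> r" if "A \<in> S" "i < n" for A i
    unfolding r_def using that fin by (intro Max_ge) (auto intro!: rev_image_eqI[of "(A, i)"])
  show ?case
  proof (intro exI[of _ "C * r + 1"] conjI allI impI)
    fix As i and \<eta> :: real assume As: "length As = Suc t" "set As \<subseteq> S" "0 \<le> \<eta>" "i < n"
    then obtain A As' where [simp]: "As = A # As'" by (cases As) auto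
    have A: "A \<in> S" using As by simp
    have "mv n A (padded_act n \<eta> As') i \<le> mv n A (\<lambda>j. act n As' (\<lambda>_. 1) j + \<eta> * C) i"
      using C(2)[of As' \<eta>] As S(1) by (intro mv_mono) (auto simp: nonneg_mats_def)
    also have "\<dots> = act n As (\<lambda>_. 1) i + \<eta> * C * mv n A (\<lambda>_. 1) i"
      by (simp add: mv_def algebra_simps sum.distrib sum_distrib_left)
    also have "\<dots> \<le> act n As (\<lambda>_. 1) i + \<eta> * C * r"
      using r[OF A As(4)] As(3) C(1) by (intro add_left_mono mult_left_mono) auto
    finally show "padded_act n \<eta> As i \<le> act n As (\<lambda>_. 1) i + \<eta> * (C * r + 1)"
      by (simp add: algebra_simps)
  qed (use C r0 in simp)
qed auto

lemma padded_act_pos: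
  assumes "set As \<subseteq> nonneg_mats n" "\<eta> > 0" "i < n"
  shows "padded_act n \<eta> As i > 0"
  using assms
proof (induction As arbitrary: i)
  case (Cons A As)
  have "0 \<le> mv n A (padded_act n \<eta> As) i"
    using Cons by (intro mv_nonneg) (auto simp: nonneg_mats_def intro: less_imp_le)
  then show ?case using Cons.prems by simp
qed simp

section \<open>Existence of rational certificates\<close>

definition rat_mats :: "nat \<Rightarrow> real mat set" where
  "rat_mats n = {A. \<forall>i<n. \<forall>j<n. A $$ (i, j) \<in> \<rat>}"

lemma mv_Rats:
  fixes v :: "nat \<Rightarrow> real"
  assumes "A \<in> rat_mats n" "\<forall>j<n. v j \<in> \<rat>" "i < n"
  shows "mv n A v i \<in> \<rat>"
  unfolding mv_def using assms by (auto simp: rat_mats_def intro!: Rats_sum)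

lemma act_Rats:
  fixes v :: "nat \<Rightarrow> real"
  assumes "set As \<subseteq> rat_mats n" "\<forall>j<n. v j \<in> \<rat>" "i < n"
  shows "act n As v i \<in> \<rat>"
  using assms(1,3)
proof (induction As arbitrary: i)
  case Nil
  then show ?case using assms(2) by simp
next
  case (Cons A As)
  then show ?case by (auto intro!: mv_Rats)
qed

text \<open>\<open>Y\<close> consists of the padded products of all words of length at most
  \<open>T\<close>. Prepending a letter stays in \<open>Y\<close> until the length exceeds
  \<open>T\<close>; by then stability has pushed the vector below the all-ones vector, the padded
  product of the empty word.\<close>

lemma contracted_vectors_if_stable:
  assumes S: "S \<subseteq> nonneg_mats n" "S \<subseteq> rat_mats n" "finite S" and n: "n \<ge> 1" and stable: "stable n S"
  obtains Y where "finite Y" "Y \<noteq> {}" "\<And>y i. y \<in> Y \<Longrightarrow> i < n \<Longrightarrow> (0::real) < y i \<and> y i \<in> \<rat>"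
    "\<And>y A. y \<in> Y \<Longrightarrow> A \<in> S \<Longrightarrow> \<exists>y'\<in>Y. \<forall>i<n. mv n A y i < y' i"
proof -
  obtain T where T: "\<And>As i. T \<le> length As \<Longrightarrow> set As \<subseteq> S \<Longrightarrow> i < n \<Longrightarrow> act n As (\<lambda>_. 1) i < (1/2 :: real)"
    using stable unfolding stable_iff_act[OF S(1) n] by (metis zero_less_divide_1_iff zero_less_numeral)
  obtain C where C: "C \<ge> 0" "\<And>As \<eta> i. length As = Suc T \<Longrightarrow> set As \<subseteq> S \<Longrightarrow> 0 \<le> \<eta> \<Longrightarrow> i < n \<Longrightarrow>
           padded_act n \<eta> As i \<le> act n As (\<lambda>_. 1) i + \<eta> * C"
    using padded_act_le[OF S(1,3), of "Suc T"] by blast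
  \<comment> \<open>The bound 1 is split in two halves, one for the product itself and one for the
    perturbation \<open>\<eta> * C\<close>. Choosing \<open>\<eta>\<close> as the reciprocal of a
    natural number keeps all vectors rational.\<close>
  obtain N :: nat where N: "2 * C < N" using reals_Archimedean2 by blast
  define \<eta> :: real where "\<eta> = 1 / N"
  have N0: "real N > 0" using N C(1) by linarith
  have \<eta>: "\<eta> > 0" "\<eta> \<in> \<rat>" "\<eta> * C < 1/2" using N N0 by (auto simp: \<eta>_def field_simps)
  define Y where "Y = padded_act n \<eta> ` {As. set As \<subseteq> S \<and> length As \<le> T}"
  have rat: "padded_act n \<eta> As i \<in> \<rat>" if "set As \<subseteq> S" "i < n" for As i
    using that
  proof (induction As arbitrary: i)
    case (Cons A As)
    then have "mv n A (padded_act n \<eta> As) i \<in> \<rat>" using S(2) by (intro mv_Rats) auto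
    then show ?case using \<eta> by simp
  qed simp
  show thesis
  proof
    show "finite Y" unfolding Y_def using finite_lists_length_le[OF S(3), of T] by simp
    show "Y \<noteq> {}" unfolding Y_def by (auto intro: exI[of _ "[]"])
    show "0 < y i \<and> y i \<in> \<rat>" if "y \<in> Y" "i < n" for y i
      using that S(1) \<eta>(1) rat by (auto simp: Y_def intro!: padded_act_pos)
  next
    fix y A assume "y \<in> Y" and A: "A \<in> S"
    then obtain As where As: "set As \<subseteq> S" "length As \<le> T" "y = padded_act n \<eta> As"
      by (auto simp: Y_def)
    have less: "mv n A y i < padded_act n \<eta> (A # As) i" for i using \<eta>(1) As by simp
    show "\<exists>y'\<in>Y. \<forall>i<n. mv n A y i < y' i"
    proof (cases "length As = T")
      case True
      have "mv n A y i < 1" if "i < n" for i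
        using less[of i] C(2)[of "A # As" \<eta> i] T[of "A # As" i] As A \<eta> that True by simp
      moreover have "(\<lambda>_. 1) \<in> Y" unfolding Y_def by (rule image_eqI[of _ _ "[]"]) auto
      ultimately show ?thesis by (intro bexI[of _ "\<lambda>_. 1"]) auto
    next
      case False
      then have "padded_act n \<eta> (A # As) \<in> Y" unfolding Y_def using As A by (intro imageI) auto
      then show ?thesis using less by blast
    qed
  qed
qed

text \<open>Each suffix of \<open>As\<close> applied to \<open>x\<close> is its first letter applied
  to the next shorter suffix. At the last letter the chain closes up, because \<open>x\<close> lies
  below the whole word applied to \<open>x\<close>, which belongs to \<open>X\<close>.\<close>

lemma supported_vectors_if_periodic:
  fixes x :: "nat \<Rightarrow> real"
  assumes S: "S \<subseteq> nonneg_mats n" "S \<subseteq> rat_mats n" and As: "set As \<subseteq> S" "As \<noteq> []"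
    and x: "\<forall>i<n. 0 \<le> x i \<and> x i \<in> \<rat>" "\<exists>i<n. 0 < x i" "\<forall>i<n. x i \<le> act n As x i"
  obtains X :: "(nat \<Rightarrow> real) set" where "finite X" "\<exists>x\<in>X. \<exists>i<n. 0 < x i"
    "\<forall>x\<in>X. \<forall>i<n. 0 \<le> x i \<and> x i \<in> \<rat>"
    "\<forall>x\<in>X. \<exists>A\<in>S. \<exists>x'\<in>X. \<forall>i<n. x i \<le> mv n A x' i"
proof -
  define X where "X = (\<lambda>k. act n (drop k As) x) ` {..<length As}"
  have set_drop: "set (drop k As) \<subseteq> S" for k using As(1) set_drop_subset by fast
  show thesis
  proof (rule that; (intro ballI allI impI)?)
    show "finite X" by (simp add: X_def)
    have "act n As x \<in> X" unfolding X_def using As by (intro image_eqI[of _ _ 0]) auto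
    moreover have "\<exists>i<n. 0 < act n As x i" using x(2,3) by (meson less_le_trans)
    ultimately show "\<exists>x\<in>X. \<exists>i<n. 0 < x i" by blast
    show "0 \<le> y i \<and> y i \<in> \<rat>" if "y \<in> X" "i < n" for y i
      using that act_Rats[OF subset_trans[OF set_drop S(2)]] x(1) act_nonneg[OF subset_trans[OF set_drop S(1)]]
      unfolding X_def by auto
  next
    fix y assume "y \<in> X"
    then obtain k where k: "k < length As" "y = act n (drop k As) x" by (auto simp: X_def)
    have y: "y = mv n (As ! k) (act n (drop (Suc k) As) x)"
      using k by (simp flip: Cons_nth_drop_Suc)
    have A: "As ! k \<in> S" using k As by auto
    show "\<exists>A\<in>S. \<exists>x'\<in>X. \<forall>i<n. y i \<le> mv n A x' i"
    proof (cases "Suc k < length As")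
      case True
      then have "act n (drop (Suc k) As) x \<in> X" by (auto simp: X_def)
      then show ?thesis using A y by blast
    next
      case False
      then have "y = mv n (As ! k) x" using k y by simp
      moreover have "mv n (As ! k) x i \<le> mv n (As ! k) (act n As x) i" if "i < n" for i
        using A S(1) x(3) that by (intro mv_mono) (auto simp: nonneg_mats_def)
      moreover have "act n As x \<in> X" unfolding X_def using As by (intro image_eqI[of _ _ 0]) auto
      ultimately show ?thesis using A by blast
    qed
  qed
qed

section \<open>Encoding a set of matrices by a pair of binary matrices\<close>

lemma power_less_iff_root:
  assumes "(0::real) \<le> r" "0 \<le> q" "0 < L"
  shows "r ^ L < q \<longleftrightarrow> r < root L q"
  using assms by (metis real_root_less_iff real_root_power_cancel)

text \<open>\<open>C\<close> is the norm of \<open>g\<close> in the supremum norm weighted by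
  \<open>y\<close>. At a coordinate where it is attained, the eigenvalue equation and the strict
  contraction can be compared directly.\<close>

lemma eigenvalue_less:
  fixes y :: "'i \<Rightarrow> real" and g h :: "'i \<Rightarrow> complex"
  assumes "finite I" "\<And>i. i \<in> I \<Longrightarrow> 0 < y i" "\<exists>i\<in>I. g i \<noteq> 0"
    and contr: "\<And>C i. i \<in> I \<Longrightarrow> 0 < C \<Longrightarrow> (\<And>j. j \<in> I \<Longrightarrow> cmod (g j) \<le> C * y j) \<Longrightarrow>
       cmod (\<mu> * g i) < C * (c * y i)"
  shows "cmod \<mu> < c"
proof -
  define R where "R = (\<lambda>i. cmod (g i) / y i) ` I"
  define C where "C = Max R"
  have R: "finite R" "R \<noteq> {}" unfolding R_def using assms(1,3) by auto
  have le: "cmod (g j) \<le> C * y j" if "j \<in> I" for j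
  proof -
    have "cmod (g j) / y j \<le> C" unfolding C_def using R that by (intro Max_ge) (auto simp: R_def)
    then show ?thesis using assms(2)[OF that] by (simp add: pos_divide_le_eq)
  qed
  obtain j where "j \<in> I" "g j \<noteq> 0" using assms(3) by blast
  then have C: "C > 0" using le[of j] assms(2)[of j]
    by (smt (verit) mult_nonpos_nonneg zero_less_norm_iff)
  have "C \<in> R" unfolding C_def using R by (intro Max_in)
  then obtain i where i: "i \<in> I" "C = cmod (g i) / y i" by (auto simp: R_def)
  then have gi: "cmod (g i) = C * y i" using assms(2)[of i] by simp
  have "cmod \<mu> * (C * y i) < c * (C * y i)"
    using contr[OF i(1) C le] by (simp add: norm_mult gi mult_ac)
  then show ?thesis using C assms(2)[OF i(1)] by (simp add: mult_less_cancel_right)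
qed

lemma concat_chunks:
  assumes "length u = L * t"
  shows "\<exists>ws. u = concat ws \<and> length ws = t \<and> (\<forall>w\<in>set ws. length w = L)"
  using assms
proof (induction t arbitrary: u)
  case (Suc t)
  then have "length (drop L u) = L * t" by simp
  from Suc.IH[OF this] obtain ws
    where ws: "drop L u = concat ws" "length ws = t" "\<forall>w\<in>set ws. length w = L" by blast
  have "u = concat (take L u # ws)" using ws(1)[symmetric] by simp
  moreover have "length (take L u) = L" using Suc.prems by simp
  ultimately show ?case using ws(2,3) by (intro exI[of _ "take L u # ws"]) simp
qed simp

text \<open>A state \<open>(v, i, k)\<close> remembers the bits \<open>v\<close> read since the last block boundary. Reading the
  \<open>L\<close>-th bit of a block \<open>w\<close> follows an edge of the multigraph with \<open>q * sel w $$ (i, j)\<close> edges from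
  \<open>i\<close> to \<open>j\<close>; the third component \<open>k\<close> is the number of the edge that was taken last, which turns
  multiplicities into distinct states.\<close>

locale binary_pair =
  fixes n L M :: nat and q :: nat and sel :: "bool list \<Rightarrow> real mat"
  assumes n: "n \<ge> 1" and L: "L \<ge> 1" and M: "M \<ge> 1" and q: "q \<ge> 1"
    and sel: "\<And>w i j. length w = L \<Longrightarrow> i < n \<Longrightarrow> j < n \<Longrightarrow> \<exists>a\<le>M. real q * sel w $$ (i, j) = real a"
begin

section \<open>The transition system and its runs\<close>

definition states :: "(bool list \<times> nat \<times> nat) set" where
  "states = {v. length v < L} \<times> {..<n} \<times> {..<M}"

definition edge :: "bool list \<Rightarrow> nat \<Rightarrow> nat \<Rightarrow> nat \<Rightarrow> bool" where
  "edge w i j l \<longleftrightarrow> real l < real q * sel w $$ (i, j)"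

fun trans :: "bool \<Rightarrow> bool list \<times> nat \<times> nat \<Rightarrow> bool list \<times> nat \<times> nat \<Rightarrow> bool" where
  "trans b (v, i, k) (v', j, l) \<longleftrightarrow>
     (if Suc (length v) < L then v' = v @ [b] \<and> j = i \<and> l = k else v' = [] \<and> edge (v @ [b]) i j l)"

text \<open>Multiplication by the adjacency matrix of the transitions labelled \<open>b\<close>,
  kept on functions of states until \<open>enum\<close> numbers the states.\<close>

definition step :: "bool \<Rightarrow> (bool list \<times> nat \<times> nat \<Rightarrow> 'b) \<Rightarrow> bool list \<times> nat \<times> nat \<Rightarrow> 'b::real_vector" where
  "step b g p = (\<Sum>p'\<in>states. of_bool (trans b p p') *\<^sub>R g p')"

definition run :: "bool list \<Rightarrow> (bool list \<times> nat \<times> nat \<Rightarrow> 'b) \<Rightarrow> bool list \<times> nat \<times> nat \<Rightarrow> 'b::real_vector" where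
  "run w g = foldr step w g"

lemma run_Nil [simp]: "run [] g = g" and run_Cons [simp]: "run (b # w) g = step b (run w g)"
  by (simp_all add: run_def)

lemma run_append: "run (u @ w) g = run u (run w g)"
  by (simp add: run_def)

lemma finite_states: "finite states"
proof -
  have "{v :: bool list. length v < L} \<subseteq> {v. set v \<subseteq> UNIV \<and> length v \<le> L}" by auto
  from finite_subset[OF this finite_lists_length_le] show ?thesis by (simp add: states_def)
qed

lemma step_cong: "(\<And>p. p \<in> states \<Longrightarrow> g p = g' p) \<Longrightarrow> step b g = step b g'"
  unfolding step_def by (intro ext sum.cong) auto

lemma run_cong: "(\<And>p. p \<in> states \<Longrightarrow> g p = g' p) \<Longrightarrow> p \<in> states \<Longrightarrow> run w g p = run w g' p"
proof (induction w arbitrary: p)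
  case (Cons b w)
  have "step b (run w g) = step b (run w g')"
    using Cons.prems(1) by (intro step_cong Cons.IH)
  then show ?case by simp
qed simp

lemma run_scale: "run w (\<lambda>p. c * g p) = (\<lambda>p. c * (run w g p :: complex))"
  by (induction w) (auto simp: step_def sum_distrib_left algebra_simps scaleR_conv_of_real)

lemma step_inner:
  assumes "(v, i, k) \<in> states" "Suc (length v) < L"
  shows "step b g (v, i, k) = g (v @ [b], i, k)"
proof -
  have "step b g (v, i, k) = (\<Sum>p'\<in>states. if p' = (v @ [b], i, k) then g p' else 0)"
    unfolding step_def by (intro sum.cong) (auto simp: assms(2))
  also have "\<dots> = g (v @ [b], i, k)"
    using assms by (subst sum.delta[OF finite_states]) (auto simp: states_def)
  finally show ?thesis .
qed

lemma step_last:
  assumes "(v, i, k) \<in> states" "Suc (length v) = L"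
  shows "step b g (v, i, k) = (\<Sum>j<n. \<Sum>l<M. of_bool (edge (v @ [b]) i j l) *\<^sub>R g ([], j, l))"
proof -
  have last: "\<not> Suc (length v) < L" using assms(2) by simp
  have "step b g (v, i, k) = (\<Sum>p'\<in>{[]} \<times> {..<n} \<times> {..<M}. of_bool (trans b (v, i, k) p') *\<^sub>R g p')"
    unfolding step_def using L last
    by (intro sum.mono_neutral_right finite_states) (auto simp: states_def)
  also have "\<dots> = (\<Sum>(v', j, l)\<in>{[] :: bool list} \<times> {..<n} \<times> {..<M}. of_bool (edge (v @ [b]) i j l) *\<^sub>R g ([], j, l))"
    using last by (intro sum.cong) auto
  also have "\<dots> = (\<Sum>j<n. \<Sum>l<M. of_bool (edge (v @ [b]) i j l) *\<^sub>R g ([], j, l))"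
    by (simp flip: sum.cartesian_product)
  finally show ?thesis .
qed

text \<open>Only the last bit of the block follows an edge, so the value depends on \<open>g\<close>
  at block boundaries alone. Starting with bits \<open>v\<close> already read serves both the
  induction and states in the middle of a block.\<close>

lemma run_block:
  assumes "length v + length w = L" "w \<noteq> []" "i < n" "k < M"
  shows "run w g (v, i, k) = (\<Sum>j<n. \<Sum>l<M. of_bool (edge (v @ w) i j l) *\<^sub>R g ([], j, l))"
  using assms(1,2)
proof (induction w arbitrary: v)
  case (Cons b w)
  have mem: "(v, i, k) \<in> states" using assms(3,4) Cons.prems by (auto simp: states_def)
  show ?case
  proof (cases "w = []")
    case True
    then show ?thesis using Cons.prems step_last[OF mem] by simp
  next
    case False
    then have "Suc (length v) < L" using Cons.prems by (cases w) auto
    from step_inner[OF mem this, of b "run w g"] show ?thesis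
      using False Cons.prems Cons.IH[of "v @ [b]"] by simp
  qed
qed simp

text \<open>The multiplicity is a natural number at most \<open>M\<close>, so that exactly this many
  of the \<open>M\<close> edge numbers occur.\<close>

lemma sum_edge:
  assumes "length w = L" "i < n" "j < n"
  shows "(\<Sum>l<M. of_bool (edge w i j l) *\<^sub>R c) = real q * sel w $$ (i, j) * (c :: real)"
proof -
  obtain a where a: "a \<le> M" "real q * sel w $$ (i, j) = real a" using sel[OF assms] by blast
  have "(\<Sum>l<M. of_bool (edge w i j l) *\<^sub>R c) = (\<Sum>l<M. if l < a then c else 0)"
    by (intro sum.cong) (auto simp: edge_def a(2))
  also have "\<dots> = (\<Sum>l<a. c)" using a(1) by (intro sum.mono_neutral_cong_right) auto
  finally show ?thesis by (simp add: a(2))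
qed

text \<open>Once edge numbers are summed out, a whole block \<open>w\<close> acts on the boundary
  states as the integer matrix \<open>q * sel w\<close>.\<close>

lemma run_concat_ones:
  assumes "\<forall>w\<in>set ws. length w = L" "i < n" "k < M"
  shows "run (concat ws) (\<lambda>_. 1) ([], i, k) = real q ^ length ws * act n (map sel ws) (\<lambda>_. 1) i"
  using assms
proof (induction ws arbitrary: i k)
  case (Cons w ws)
  have w: "length w = L" "w \<noteq> []" using Cons.prems L by auto
  have "run (concat (w # ws)) (\<lambda>_. 1) ([], i, k) =
      (\<Sum>j<n. \<Sum>l<M. of_bool (edge w i j l) *\<^sub>R run (concat ws) (\<lambda>_. 1 :: real) ([], j, l))"
    using run_block[of "[]" w i k "run (concat ws) (\<lambda>_. 1 :: real)"] w Cons.prems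
    by (simp add: run_append del: sum_of_bool_eq sum_of_bool_mult_eq sum_mult_of_bool_eq scaleR_conv_of_real real_scaleR_def)
  also have "\<dots> = (\<Sum>j<n. \<Sum>l<M. of_bool (edge w i j l) *\<^sub>R (real q ^ length ws * act n (map sel ws) (\<lambda>_. 1) j))"
    using Cons by (intro sum.cong) auto
  also have "\<dots> = (\<Sum>j<n. real q * sel w $$ (i, j) * (real q ^ length ws * act n (map sel ws) (\<lambda>_. 1) j))"
    using w Cons.prems by (intro sum.cong sum_edge) auto
  finally show ?case by (simp add: mv_def sum_distrib_left mult_ac)
qed simp

lemma cmod_run_concat_le:
  assumes "\<forall>w\<in>set ws. length w = L" "i < n" "k < M"
    and g: "\<And>j l. j < n \<Longrightarrow> l < M \<Longrightarrow> cmod (g ([], j, l)) \<le> C * y j"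
  shows "cmod (run (concat ws) g ([], i, k)) \<le> C * (real q ^ length ws * act n (map sel ws) y i)"
  using assms(1-3)
proof (induction ws arbitrary: i k)
  case Nil
  then show ?case using g by simp
next
  case (Cons w ws)
  have w: "length w = L" "w \<noteq> []" using Cons.prems L by auto
  have "cmod (run (concat (w # ws)) g ([], i, k)) =
      cmod (\<Sum>j<n. \<Sum>l<M. of_bool (edge w i j l) *\<^sub>R run (concat ws) g ([], j, l))"
    using run_block[of "[]" w i k "run (concat ws) g"] w Cons.prems by (simp add: run_append)
  also have "\<dots> \<le> (\<Sum>j<n. \<Sum>l<M. of_bool (edge w i j l) *\<^sub>R cmod (run (concat ws) g ([], j, l)))"
    by (intro order.trans[OF norm_sum] sum_mono) simp
  also have "\<dots> \<le> (\<Sum>j<n. \<Sum>l<M. of_bool (edge w i j l) *\<^sub>R (C * (real q ^ length ws * act n (map sel ws) y j)))"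
    using Cons by (intro sum_mono) auto
  also have "\<dots> = (\<Sum>j<n. real q * sel w $$ (i, j) * (C * (real q ^ length ws * act n (map sel ws) y j)))"
    using w Cons.prems by (intro sum.cong sum_edge) auto
  finally show ?case by (simp add: mv_def sum_distrib_left mult_ac)
qed

text \<open>An eigenvector need not be supported at the block boundary; rotating the word so that it
  starts at a state supporting the eigenvector moves it there.\<close>

lemma eigenvalue_power_less:
  assumes eig: "\<And>p. p \<in> states \<Longrightarrow> run w g p = \<mu> * g p" and p: "p \<in> states" "g p \<noteq> 0"
    and t: "length w = t" "t \<ge> 1"
    and contr: "\<And>ws. length ws = t \<Longrightarrow> \<forall>w\<in>set ws. length w = L \<Longrightarrow>
       \<exists>y. (\<forall>i<n. 0 < y i) \<and> (\<forall>i<n. act n (map sel ws) y i < (y i :: real))"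
  shows "cmod \<mu> ^ L < real q ^ t"
proof (cases "\<mu> = 0")
  case True
  then show ?thesis using L q by (simp add: power_0_left)
next
  case False
  \<comment> \<open>The length \<open>t\<close> of \<open>w\<close> need not be a multiple of
    \<open>L\<close>, but \<open>L\<close> copies of \<open>w\<close> can be cut into exactly
    \<open>t\<close> blocks.\<close>
  define wL where "wL = concat (replicate L w)"
  have len: "length wL = L * t" using t by (simp add: wL_def length_concat sum_list_replicate)
  have "run (concat (replicate m w)) g p = \<mu> ^ m * g p" if "p \<in> states" for m p
    using that
  proof (induction m arbitrary: p)
    case (Suc m)
    have "run w (run (concat (replicate m w)) g) p = run w (\<lambda>p. \<mu> ^ m * g p) p"
      using Suc by (intro run_cong)
    then show ?case using eig[OF Suc.prems] by (simp add: run_append run_scale)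
  qed simp
  then have eigL: "run wL g p = \<mu> ^ L * g p" if "p \<in> states" for p
    using that by (simp add: wL_def)
  obtain v i k where p': "p = (v, i, k)" "length v < L" "i < n" "k < M"
    using p(1) by (auto simp: states_def)
  \<comment> \<open>The number of bits that \<open>p\<close> still has to read to reach the next
    block boundary.\<close>
  define d where "d = L - length v"
  have d: "d \<le> L * t" "d \<ge> 1" "length v + d = L" using t p'(2) unfolding d_def
    by (auto intro: order.trans[of _ L])
  define w1 where "w1 = take d wL"
  define w2 where "w2 = drop d wL"
  have w12: "wL = w1 @ w2" by (simp add: w1_def w2_def)
  define h where "h = run w2 g"
  \<comment> \<open>Reading \<open>w1\<close> from \<open>p\<close> completes the block begun by
    \<open>v\<close>, so this nonzero value is a combination of values of \<open>h\<close> at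
    boundary states; one of them is nonzero.\<close>
  have "run w1 h p \<noteq> 0"
    using eigL[OF p(1)] p(2) False by (simp add: h_def w12 run_append)
  moreover have "length w1 = d" using d len by (simp add: w1_def)
  ultimately obtain j l where jl: "j < n" "l < M" "h ([], j, l) \<noteq> 0"
    using run_block[of v w1 i k h] p' d
    by (smt (verit) One_nat_def Suc_n_not_le_n lessThan_iff list.size(3) scaleR_eq_0_iff sum.neutral)
  have mem: "([], j, l) \<in> states" if "j < n" "l < M" for j l
    using that L by (auto simp: states_def)
  \<comment> \<open>Moving \<open>w1\<close> behind \<open>w2\<close> turns
    \<open>h = run w2 g\<close> into an eigenvector on the boundary states, with the same
    eigenvalue.\<close>
  have eig_h: "run (w2 @ w1) h ([], j, l) = \<mu> ^ L * h ([], j, l)" if "j < n" "l < M" for j l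
  proof -
    have "run (w2 @ w1) h ([], j, l) = run w2 (run wL g) ([], j, l)"
      by (simp add: h_def run_append w12)
    also have "\<dots> = run w2 (\<lambda>p. \<mu> ^ L * g p) ([], j, l)"
      using eigL mem[OF that] by (intro run_cong)
    finally show ?thesis by (simp add: run_scale h_def)
  qed
  have "length (w2 @ w1) = L * t" using len by (simp add: w12)
  then obtain ws where ws: "w2 @ w1 = concat ws" "length ws = t" "\<forall>w\<in>set ws. length w = L"
    using concat_chunks by blast
  obtain y where y: "\<forall>i<n. 0 < y i" "\<forall>i<n. act n (map sel ws) y i < (y i :: real)"
    using contr[OF ws(2,3)] by blast
  have "cmod (\<mu> ^ L) < real q ^ t"
  proof (rule eigenvalue_less[where I = "{..<n} \<times> {..<M}" and y = "\<lambda>(j, l). y j" and g = "\<lambda>(j, l). h ([], j, l)"])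
    fix C p assume p: "p \<in> {..<n} \<times> {..<M}" and C: "(0::real) < C"
      and le: "\<And>j. j \<in> {..<n} \<times> {..<M} \<Longrightarrow>
        cmod (case j of (j, l) \<Rightarrow> h ([], j, l)) \<le> C * (case j of (j, l) \<Rightarrow> y j)"
    obtain j l where jl: "p = (j, l)" "j < n" "l < M" using p by auto
    have "cmod (run (concat ws) h ([], j, l)) \<le> C * (real q ^ t * act n (map sel ws) y j)"
      using cmod_run_concat_le[OF ws(3) jl(2,3), of h C y] le ws(2) by force
    also have "\<dots> < C * (real q ^ t * y j)"
      using C q y jl by (intro mult_strict_left_mono) auto
    finally show "cmod (\<mu> ^ L * (case p of (j, l) \<Rightarrow> h ([], j, l))) <
        C * (real q ^ t * (case p of (j, l) \<Rightarrow> y j))"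
      using eig_h[OF jl(2,3)] by (simp add: jl(1) ws(1))
  qed (use y jl in auto)
  then show ?thesis by (simp add: norm_power)
qed

section \<open>The two binary matrices\<close>

definition N :: nat where "N = card states"

definition enum :: "nat \<Rightarrow> bool list \<times> nat \<times> nat" where
  "enum = (SOME h. bij_betw h {..<N} states)"

lemma enum: "bij_betw enum {..<N} states"
proof -
  have "\<exists>h. bij_betw h {..<N} states"
    using ex_bij_betw_nat_finite[OF finite_states] unfolding N_def by (simp add: atLeast0LessThan)
  then show ?thesis unfolding enum_def by (rule someI_ex)
qed

definition bmat :: "bool \<Rightarrow> real mat" where
  "bmat b = mat N N (\<lambda>(s, s'). of_bool (trans b (enum s) (enum s')))"

lemma N: "N \<ge> 1"
proof -
  have "([], 0, 0) \<in> states" using n L M by (auto simp: states_def)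
  then show ?thesis unfolding N_def using finite_states card_gt_0_iff[of states] by auto
qed

lemma bmat_carrier: "bmat b \<in> carrier_mat N N"
  by (simp add: bmat_def)

lemma binary_bmat: "binary_mat (bmat b)"
  by (auto simp: binary_mat_def elements_mat_def bmat_def)

lemma bmat_nonneg: "bmat b \<in> nonneg_mats N"
  by (auto simp: nonneg_mats_def bmat_def)

lemma mv_bmat:
  assumes "s < N" "\<And>s. s < N \<Longrightarrow> v s = g (enum s)"
  shows "mv N (bmat b) v s = step b g (enum s)"
proof -
  have "mv N (bmat b) v s = (\<Sum>s'\<in>{..<N}. of_bool (trans b (enum s) (enum s')) *\<^sub>R g (enum s'))"
    unfolding mv_def using assms by (intro sum.cong) (auto simp: bmat_def)
  also have "\<dots> = step b g (enum s)"
    unfolding step_def by (rule sum.reindex_bij_betw[OF enum])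
  finally show ?thesis .
qed

lemma act_bmat:
  assumes "s < N" "\<And>s. s < N \<Longrightarrow> v s = g (enum s)"
  shows "act N (map bmat w) v s = run w g (enum s)"
  using assms(1)
proof (induction w arbitrary: s)
  case (Cons b w)
  then show ?case by (simp add: mv_bmat)
qed (use assms(2) in simp)

text \<open>The left side is the row sum of the binary product at the boundary state
  \<open>([], i, 0)\<close>, and the norm is the largest row sum.\<close>

lemma act_ones_le_norm:
  assumes "\<forall>w\<in>set ws. length w = L" "i < n"
  shows "real q ^ length ws * act n (map sel ws) (\<lambda>_. 1) i \<le>
    mat_norm (foldr (*) (map bmat (concat ws)) (1\<^sub>m N))"
proof -
  have "([], i, 0) \<in> states" using assms L M by (auto simp: states_def)
  then obtain s where s: "s < N" "enum s = ([], i, 0)"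
    using enum unfolding bij_betw_def by (metis imageE lessThan_iff)
  have "set (map bmat (concat ws)) \<subseteq> nonneg_mats N" using bmat_nonneg by auto
  note norm = mat_norm_eq_act[OF this]
  have "real q ^ length ws * act n (map sel ws) (\<lambda>_. 1) i = act N (map bmat (concat ws)) (\<lambda>_. 1) s"
    using run_concat_ones[OF assms, of 0] M act_bmat[OF s(1), of "\<lambda>_. 1" "\<lambda>_. 1 :: real"] s(2) by simp
  also have "\<dots> \<le> mat_norm (foldr (*) (map bmat (concat ws)) (1\<^sub>m N))"
    unfolding norm using s(1) by (intro Max_ge) auto
  finally show ?thesis .
qed

end

text \<open>The joint spectral radius of the pair is attained at one product \<open>B\<close>, where
  \<open>eigenvalue_power_less\<close> applies. Hence its \<open>L\<close>-th power is strictly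
  below \<open>q\<close>, which bounds the norms of all long binary products, and these dominate the
  scaled products over \<open>S\<close>.\<close>

lemma (in binary_pair) stable_if_finiteness_property:
  assumes S: "sel ` {w. length w = L} = S" "S \<subseteq> nonneg_mats n"
    and fp: "finiteness_property N {bmat False, bmat True}"
    and contr: "\<And>As. As \<noteq> [] \<Longrightarrow> set As \<subseteq> S \<Longrightarrow>
       \<exists>y. (\<forall>i<n. 0 < y i) \<and> (\<forall>i<n. act n As y i < (y i :: real))"
  shows "stable n S"
proof -
  have range_bmat: "range bmat = {bmat False, bmat True}" by (auto simp: UNIV_bool)
  obtain t B where t: "t \<ge> 1" and B: "B \<in> mat_prods N {bmat False, bmat True} t"
    and jsr: "joint_spectral_radius N {bmat False, bmat True} =
      ereal (root t (spectral_radius (map_mat complex_of_real B)))"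
    using fp unfolding finiteness_property_def by blast
  obtain Bs where Bs: "length Bs = t" "set Bs \<subseteq> range bmat" "B = foldr (*) Bs (1\<^sub>m N)"
    using B unfolding mat_prods_def range_bmat by blast
  obtain w where w: "Bs = map bmat w"
    using Bs(2) ex_map_conv[of Bs bmat] by blast
  have carrier: "set Bs \<subseteq> carrier_mat N N" using Bs(2) bmat_carrier by auto
  define BC where "BC = map_mat complex_of_real B"
  have Bc: "B \<in> carrier_mat N N" unfolding Bs(3) by (rule foldr_mat_carrier[OF carrier])
  then have BC: "BC \<in> carrier_mat N N" by (simp add: BC_def)
  obtain \<mu> where \<mu>: "\<mu> \<in> spectrum BC" "spectral_radius BC = cmod \<mu>"
    using spectral_radius_mem_max(1)[OF BC] N by auto
  obtain v where v: "v \<in> carrier_vec N" "v \<noteq> 0\<^sub>v N" "BC *\<^sub>v v = \<mu> \<cdot>\<^sub>v v"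
    using \<mu>(1) BC unfolding spectrum_def eigenvalue_def eigenvector_def by auto
  \<comment> \<open>The eigenvector read as a function on states.\<close>
  define g where "g p = v $ inv_into {..<N} enum p" for p
  have g: "g (enum s) = v $ s" if "s < N" for s
    using that enum by (simp add: g_def bij_betw_def)
  have eig: "run w g p = \<mu> * g p" if p: "p \<in> states" for p
  proof -
    obtain s where s: "s < N" "p = enum s"
      using enum p unfolding bij_betw_def by (metis imageE lessThan_iff)
    have "run w g p = act N (map bmat w) (($) v) s"
      using act_bmat[OF s(1), of "($) v" g w] g s(2) by simp
    also have "\<dots> = mv N B (($) v) s"
      using mv_foldr[OF carrier s(1), of "($) v"] by (simp add: Bs(3) w)
    also have "\<dots> = (BC *\<^sub>v v) $ s"
      using s(1) Bc v(1) by (simp add: mv_def BC_def scalar_prod_def atLeast0LessThan scaleR_conv_of_real)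
    also have "\<dots> = \<mu> * g p" using s v(1) by (simp add: v(3) g)
    finally show ?thesis .
  qed
  obtain s where s: "s < N" "v $ s \<noteq> 0" using v(1,2) by (auto simp: vec_eq_iff)
  have "cmod \<mu> ^ L < real q ^ t"
  proof (rule eigenvalue_power_less[where p = "enum s" and w = w and g = g])
    show "enum s \<in> states" using s(1) enum by (auto simp: bij_betw_def)
    show "\<exists>y. (\<forall>i<n. 0 < y i) \<and> (\<forall>i<n. act n (map sel ws) y i < (y i :: real))"
      if "length ws = t" "\<forall>w\<in>set ws. length w = L" for ws
      using that t S(1) by (intro contr) auto
  qed (use eig s g t Bs(1) w in auto)
  \<comment> \<open>By the choice of \<open>B\<close> and \<open>\<mu>\<close> this is the joint
    spectral radius of the pair.\<close>
  define r where "r = root t (cmod \<mu>)"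
  have r: "r \<ge> 0" "r ^ t = cmod \<mu>" using t by (simp_all add: r_def)
  have "(r ^ L) ^ t = cmod \<mu> ^ L" unfolding r(2)[symmetric] by (simp only: power_mult[symmetric] mult.commute)
  also note \<open>cmod \<mu> ^ L < real q ^ t\<close>
  finally have "(r ^ L) ^ t < real q ^ t" .
  then have "r ^ L < real q" by (rule power_less_imp_less_base) simp
  then have r_less: "r < root L (real q)" using r(1) L by (simp add: power_less_iff_root)
  \<comment> \<open>A value strictly in between leaves room twice: norms of long binary products of
    length \<open>m\<close> fall below \<open>c ^ m\<close>, and \<open>c ^ L / q\<close> is still
    less than 1.\<close>
  define c where "c = (r + root L (real q)) / 2"
  have c: "r < c" "0 < c" "c < root L (real q)" using r_less r(1) by (simp_all add: c_def)
  then have cL: "c ^ L < real q" using L by (simp add: power_less_iff_root)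
  have "joint_spectral_radius N (range bmat) < ereal c"
    using c(1) \<mu>(2) by (simp add: jsr range_bmat r_def BC_def)
  then have "\<forall>\<^sub>F t in sequentially. ereal (Max ((\<lambda>A. root t (mat_norm A)) ` mat_prods N (range bmat) t)) < ereal c"
    unfolding joint_spectral_radius_def by (rule Limsup_lessD)
  then obtain T where T: "\<And>t. t \<ge> T \<Longrightarrow> Max ((\<lambda>A. root t (mat_norm A)) ` mat_prods N (range bmat) t) < c"
    by (auto simp: eventually_sequentially)
  have norm_less: "mat_norm (foldr (*) (map bmat w) (1\<^sub>m N)) < c ^ length w"
    if len: "length w \<ge> T" "length w \<ge> 1" for w
  proof -
    define P where "P = foldr (*) (map bmat w) (1\<^sub>m N)"
    have mem: "P \<in> mat_prods N (range bmat) (length w)"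
      unfolding mat_prods_def P_def by (auto intro!: exI[of _ "map bmat w"])
    have "mat_prods N (range bmat) (length w) =
        (\<lambda>As. foldr (*) As (1\<^sub>m N)) ` {As. set As \<subseteq> range bmat \<and> length As = length w}"
      by (auto simp: mat_prods_def)
    then have "finite (mat_prods N (range bmat) (length w))"
      using finite_lists_length_eq[of "range bmat" "length w"] by (simp add: range_bmat)
    then have "root (length w) (mat_norm P) \<le>
        Max ((\<lambda>A. root (length w) (mat_norm A)) ` mat_prods N (range bmat) (length w))"
      using mem by (intro Max_ge) auto
    also have "\<dots> < c" using T len by blast
    also have "c = root (length w) (c ^ length w)"
      using len(2) c(2) by (intro real_root_power_cancel[symmetric]) auto
    finally show ?thesis using len(2) by (simp add: P_def Suc_le_eq)
  qed
  define \<theta> where "\<theta> = c ^ L / real q"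
  have \<theta>: "0 \<le> \<theta>" "\<theta> < 1" using c(2) cL q by (auto simp: \<theta>_def)
  show ?thesis
    unfolding stable_iff_act[OF S(2) n]
  proof (intro allI impI)
    fix \<epsilon> :: real assume "\<epsilon> > 0"
    then obtain T1 where T1: "\<theta> ^ T1 < \<epsilon>" using real_arch_pow_inv \<theta>(2) by blast
    \<comment> \<open>In the length bound, \<open>T\<close> makes the norm estimate available,
      \<open>T1\<close> makes the power of \<open>\<theta>\<close> small, and 1 excludes the empty
      word.\<close>
    have "act n As (\<lambda>_. 1) i < \<epsilon>"
      if As: "T + T1 + 1 \<le> length As" "set As \<subseteq> S" and i: "i < n" for As i
    proof -
      have "\<forall>A\<in>set As. \<exists>w. length w = L \<and> A = sel w" using As(2) S(1) by auto
      then obtain f where f: "\<And>A. A \<in> set As \<Longrightarrow> length (f A) = L \<and> A = sel (f A)" by metis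
      define ws where "ws = map f As"
      have ws: "As = map sel ws" "\<forall>w\<in>set ws. length w = L" "length ws = length As"
        using f by (auto simp: ws_def map_idI)
      have len: "length (concat ws) = L * length As"
        using ws(2) unfolding ws(3)[symmetric] by (induction ws) auto
      have "length As \<le> L * length As" using L by simp
      with As have "length (concat ws) \<ge> T" "length (concat ws) \<ge> 1" unfolding len by linarith+
      note norm_less[OF this]
      moreover have "real q ^ length As * act n As (\<lambda>_. 1) i \<le>
          mat_norm (foldr (*) (map bmat (concat ws)) (1\<^sub>m N))"
        using act_ones_le_norm[OF ws(2) i] ws(3) by (simp flip: ws(1))
      ultimately have "real q ^ length As * act n As (\<lambda>_. 1) i < (c ^ L) ^ length As"
        by (simp add: len power_mult)
      then have "act n As (\<lambda>_. 1) i < \<theta> ^ length As"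
        using q by (simp add: \<theta>_def power_divide pos_less_divide_eq mult.commute)
      also have "\<dots> \<le> \<theta> ^ T1" using As \<theta> by (intro power_decreasing) auto
      finally show ?thesis using T1 by simp
    qed
    then show "\<exists>T. \<forall>As. T \<le> length As \<longrightarrow> set As \<subseteq> S \<longrightarrow> (\<forall>i<n. act n As (\<lambda>_. 1) i < \<epsilon>)"
      by blast
  qed
qed

section \<open>Rational data and the choice of the encoding\<close>

lemma common_denominator:
  assumes "finite F" "F \<subseteq> \<rat>" "\<And>x. x \<in> F \<Longrightarrow> (0::real) \<le> x"
  obtains q :: nat where "q \<ge> 1" "\<And>x. x \<in> F \<Longrightarrow> \<exists>k::nat. real q * x = real k"
proof -
  have "\<exists>q\<ge>1::nat. \<forall>x\<in>F. \<exists>k::nat. real q * x = real k"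
    using assms
  proof (induction F rule: finite_induct)
    case (insert x F)
    then obtain q where q: "q \<ge> 1" "\<And>x. x \<in> F \<Longrightarrow> \<exists>k::nat. real q * x = real k" by auto
    have "x \<in> \<rat>" using insert.prems(1) by simp
    then obtain m d :: nat where md: "d \<noteq> 0" "\<bar>x\<bar> = real m / real d"
      by (elim Rats_abs_nat_div_natE) (rule that)
    then have x: "real d * x = real m" using insert.prems(2)[of x] by simp
    show ?case
    proof (rule exI[of _ "q * d"], intro conjI ballI)
      fix z assume "z \<in> insert x F"
      then consider "z = x" | "z \<in> F" by blast
      then show "\<exists>k::nat. real (q * d) * z = real k"
      proof cases
        case 1
        then show ?thesis using x by (intro exI[of _ "q * m"]) simp
      next
        case 2
        then obtain k :: nat where "real q * z = real k" using q(2) by blast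
        then show ?thesis by (intro exI[of _ "k * d"]) (simp add: mult_ac flip: \<open>real q * z = real k\<close>)
      qed
    qed (use q md in simp)
  qed auto
  then show ?thesis using that by blast
qed

text \<open>The alternative is applied over the field of rationals, to the entries of the product,
  so that the vector \<open>x\<close> comes out rational and can be part of a certificate.\<close>

lemma rational_matrix_alternative:
  assumes "set As \<subseteq> nonneg_mats n" "set As \<subseteq> rat_mats n"
  shows "(\<exists>x :: nat \<Rightarrow> real. (\<forall>i<n. 0 \<le> x i \<and> x i \<in> \<rat>) \<and> (\<exists>i<n. 0 < x i) \<and> (\<forall>i<n. x i \<le> act n As x i)) \<or>
         (\<exists>y :: nat \<Rightarrow> real. (\<forall>i<n. 0 < y i) \<and> (\<forall>i<n. act n As y i < y i))"
proof -
  define P where "P = foldr (*) As (1\<^sub>m n)"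
  have C: "set As \<subseteq> carrier_mat n n" using assms(1) by (auto simp: nonneg_mats_def)
  have act: "act n As v i = mv n P v i" if "i < n" for v :: "nat \<Rightarrow> real" and i
    unfolding P_def by (rule mv_foldr[OF C that, symmetric])
  have "P $$ (i, j) \<in> \<rat>" if ij: "i < n" "j < n" for i j
  proof -
    \<comment> \<open>Entries of the product are read off from its action on unit vectors.\<close>
    have "act n As (\<lambda>k. of_bool (k = j) :: real) i \<in> \<rat>"
      using assms(2) ij by (intro act_Rats) auto
    then show ?thesis using ij by (simp add: act mv_def)
  qed
  then have "\<forall>i<n. \<forall>j<n. \<exists>a. P $$ (i, j) = real_of_rat a" by (auto elim!: Rats_cases)
  then obtain a where a: "\<And>i j. i < n \<Longrightarrow> j < n \<Longrightarrow> P $$ (i, j) = real_of_rat (a i j)" by metis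
  have a0: "\<forall>i<n. \<forall>j<n. 0 \<le> a i j"
    using foldr_mat_nonneg[OF assms(1)] a by (metis P_def zero_le_of_rat_iff)
  have act_rat: "act n As (\<lambda>j. real_of_rat (z j)) i = real_of_rat (\<Sum>j<n. a i j * z j)"
    if "i < n" for z i
    using that by (simp add: act mv_def a of_rat_sum of_rat_mult)
  from nonneg_matrix_alternative[OF a0] show ?thesis
  proof
    assume "\<exists>x. (\<forall>i<n. 0 \<le> x i) \<and> (\<exists>i<n. 0 < x i) \<and> (\<forall>i<n. x i \<le> (\<Sum>j<n. a i j * x j))"
    then obtain x where "\<forall>i<n. 0 \<le> x i" "\<exists>i<n. 0 < x i" "\<forall>i<n. x i \<le> (\<Sum>j<n. a i j * x j)" by blast
    then show ?thesis
      by (intro disjI1 exI[of _ "\<lambda>i. real_of_rat (x i)"]) (auto simp: act_rat of_rat_less_eq)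
  next
    assume "\<exists>y. (\<forall>i<n. 0 < y i) \<and> (\<forall>i<n. (\<Sum>j<n. a i j * y j) < y i)"
    then obtain y where "\<forall>i<n. 0 < y i" "\<forall>i<n. (\<Sum>j<n. a i j * y j) < y i" by blast
    then show ?thesis
      by (intro disjI2 exI[of _ "\<lambda>i. real_of_rat (y i)"]) (auto simp: act_rat of_rat_less)
  qed
qed

lemma periodic_if_not_stable:
  assumes fp: "\<And>(N::nat) (A::real mat) (B::real mat).
      \<lbrakk>N \<ge> 1; A \<in> carrier_mat N N; B \<in> carrier_mat N N; binary_mat A; binary_mat B\<rbrakk>
      \<Longrightarrow> finiteness_property N {A, B}"
    and S: "S \<subseteq> nonneg_mats n" "S \<subseteq> rat_mats n" "finite S" "S \<noteq> {}" and n: "n \<ge> 1"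
    and unstable: "\<not> stable n S"
  obtains As and x :: "nat \<Rightarrow> real" where "set As \<subseteq> S" "As \<noteq> []"
    "\<forall>i<n. 0 \<le> x i \<and> x i \<in> \<rat>" "\<exists>i<n. 0 < x i" "\<forall>i<n. x i \<le> act n As x i"
proof (rule ccontr)
  note periodic = that
  assume contra: "\<not> thesis"
  have no: "\<not> (\<exists>x. (\<forall>i<n. 0 \<le> x i \<and> x i \<in> \<rat>) \<and> (\<exists>i<n. (0::real) < x i) \<and> (\<forall>i<n. x i \<le> act n As x i))"
    if "set As \<subseteq> S" "As \<noteq> []" for As
    using that periodic[of As] contra by blast
  define F where "F = (\<lambda>(A, i, j). A $$ (i, j)) ` (S \<times> {..<n} \<times> {..<n})"
  have F: "finite F" "F \<subseteq> \<rat>" "\<And>x. x \<in> F \<Longrightarrow> 0 \<le> x"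
    using S by (auto simp: F_def nonneg_mats_def rat_mats_def)
  have in_F: "A $$ (i, j) \<in> F" if "A \<in> S" "i < n" "j < n" for A i j
    unfolding F_def using that by (auto intro!: rev_image_eqI[of "(A, i, j)"])
  obtain q where q: "q \<ge> 1" "\<And>x. x \<in> F \<Longrightarrow> \<exists>k::nat. real q * x = real k"
    using common_denominator[OF F] by blast
  obtain k where k: "\<And>x. x \<in> F \<Longrightarrow> real q * x = real (k x)" using q(2) by metis
  \<comment> \<open>The inserted 1 ensures \<open>M \<ge> 1\<close>, hence the existence of states,
    even if all matrices vanish.\<close>
  define M where "M = Max (insert 1 (k ` F))"
  have M: "1 \<le> M" "\<And>x. x \<in> F \<Longrightarrow> k x \<le> M" unfolding M_def using F(1) by auto
  obtain Ml where Ml: "set Ml = S" using finite_list[OF S(3)] by blast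
  define L where "L = length Ml"
  have L: "L \<ge> 1" using Ml S(4) by (cases Ml) (auto simp: L_def)
  \<comment> \<open>The number of leading \<open>False\<close> bits selects the matrix. A word of
    \<open>L\<close> bits has between 0 and \<open>L\<close> of them; \<open>mod L\<close> sends the
    all-\<open>False\<close> word to index 0.\<close>
  define sel where "sel w = Ml ! (length (takeWhile Not w) mod L)" for w
  have sel_S: "sel w \<in> S" for w
    unfolding sel_def Ml[symmetric] using L unfolding L_def by (intro nth_mem mod_less_divisor) linarith
  have "\<exists>w. length w = L \<and> A = sel w" if A: "A \<in> S" for A
  proof -
    obtain m where m: "m < L" "A = Ml ! m" using A Ml unfolding L_def by (metis in_set_conv_nth)
    then show ?thesis
      by (intro exI[of _ "replicate m False @ replicate (L - m) True"])
        (auto simp: sel_def takeWhile_append)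
  qed
  then have sel_image: "sel ` {w. length w = L} = S" using sel_S by blast
  interpret binary_pair n L M q sel
  proof
    fix w :: "bool list" and i j assume ij: "i < n" "j < n"
    show "\<exists>a\<le>M. real q * sel w $$ (i, j) = real a"
      using k[OF in_F[OF sel_S ij]] M(2)[OF in_F[OF sel_S ij]] by blast
  qed (use n L M q in auto)
  have "stable n S"
  proof (rule stable_if_finiteness_property[OF sel_image S(1)])
    show "finiteness_property N {bmat False, bmat True}"
      by (intro fp N bmat_carrier binary_bmat)
    fix As assume As: "As \<noteq> []" "set As \<subseteq> S"
    note alt = rational_matrix_alternative[OF subset_trans[OF As(2) S(1)] subset_trans[OF As(2) S(2)]]
    show "\<exists>y. (\<forall>i<n. 0 < y i) \<and> (\<forall>i<n. act n As y i < (y i :: real))"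
      by (rule mp[OF disj_imp[THEN iffD1, OF alt] no[OF As(2,1)]])
  qed
  then show False using unstable by blast
qed

section \<open>Checking certificates\<close>

definition inst_dim :: "nat \<Rightarrow> nat" where "inst_dim c = code_fst c"
definition inst_mats :: "nat \<Rightarrow> nat" where "inst_mats c = code_snd c"
definition inst_entry :: "nat \<Rightarrow> nat \<Rightarrow> nat \<Rightarrow> nat \<Rightarrow> nat" where
  "inst_entry c a i j = code_nth (code_nth (code_nth (inst_mats c) a) i) j"

text \<open>\<^const>\<open>list_encode\<close> maps only the empty list to \<open>0\<close>.\<close>

definition inst_index :: "nat \<Rightarrow> nat \<Rightarrow> bool" where
  "inst_index c a \<longleftrightarrow> code_drop (inst_mats c) a \<noteq> 0"

text \<open>A witness is the code of a list of four items: the number of vectors, a common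
  denominator, the matrices scaled by it, and the vectors.\<close>

definition wit_size :: "nat \<Rightarrow> nat" where "wit_size w = code_nth w 0"
definition wit_denom :: "nat \<Rightarrow> nat" where "wit_denom w = code_nth w 1"
definition wit_mat :: "nat \<Rightarrow> nat \<Rightarrow> nat \<Rightarrow> nat \<Rightarrow> nat" where
  "wit_mat w a i j = code_nth (code_nth (code_nth (code_nth w 2) a) i) j"
definition wit_vec :: "nat \<Rightarrow> nat \<Rightarrow> nat \<Rightarrow> nat" where
  "wit_vec w k i = code_nth (code_nth (code_nth w 3) k) i"

text \<open>The code of the matrix list is at least its length and so bounds the index
  \<open>a\<close>; \<open>inst_index\<close> discards the surplus indices. The equation is
  cross-multiplied to stay within the natural numbers.\<close>

definition scaling_witness :: "nat \<Rightarrow> nat \<Rightarrow> bool" where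
  "scaling_witness w c \<longleftrightarrow> 0 < wit_denom w \<and>
     (\<forall>a<inst_mats c. inst_index c a \<longrightarrow> (\<forall>i<inst_dim c. \<forall>j<inst_dim c.
        wit_mat w a i j * code_snd (inst_entry c a i j) = wit_denom w * code_fst (inst_entry c a i j)))"

definition stable_witness :: "nat \<Rightarrow> nat \<Rightarrow> bool" where
  "stable_witness w c \<longleftrightarrow> scaling_witness w c \<and> 0 < wit_size w \<and>
     (\<forall>k<wit_size w. (\<forall>i<inst_dim c. 0 < wit_vec w k i) \<and>
        (\<forall>a<inst_mats c. inst_index c a \<longrightarrow> (\<exists>k'<wit_size w. \<forall>i<inst_dim c.
           (\<Sum>j<inst_dim c. wit_mat w a i j * wit_vec w k j) < wit_denom w * wit_vec w k' i)))"

definition unstable_witness :: "nat \<Rightarrow> nat \<Rightarrow> bool" where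
  "unstable_witness w c \<longleftrightarrow> scaling_witness w c \<and>
     (\<exists>k<wit_size w. \<exists>i<inst_dim c. 0 < wit_vec w k i) \<and>
     (\<forall>k<wit_size w. \<exists>a<inst_mats c. inst_index c a \<and> (\<exists>k'<wit_size w. \<forall>i<inst_dim c.
        wit_denom w * wit_vec w k i \<le> (\<Sum>j<inst_dim c. wit_mat w a i j * wit_vec w k' j)))"

section \<open>Computability of the checks and packing of witnesses\<close>

lemmas comp_intros = comp_fun_const comp_fun_var comp_fun_add comp_fun_mult comp_fun_sum
  comp_fun_code_fst comp_fun_code_snd comp_fun_code_nth comp_fun_code_drop
  comp_pred_conj comp_pred_imp comp_pred_not comp_pred_all comp_pred_ex
  comp_pred_less comp_pred_le comp_pred_eq

lemma comp_pred_scaling_witness: "comp_pred 2 (\<lambda>e. scaling_witness (e 0) (e 1))"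
  unfolding scaling_witness_def inst_dim_def inst_mats_def inst_entry_def inst_index_def
    wit_denom_def wit_mat_def
  by (intro comp_intros) simp_all

lemma comp_pred_stable_witness: "comp_pred 2 (\<lambda>e. stable_witness (e 0) (e 1))"
  unfolding stable_witness_def inst_dim_def inst_mats_def inst_entry_def inst_index_def
    wit_denom_def wit_mat_def wit_size_def wit_vec_def
  by (intro comp_intros comp_pred_scaling_witness) simp_all

lemma comp_pred_unstable_witness: "comp_pred 2 (\<lambda>e. unstable_witness (e 0) (e 1))"
  unfolding unstable_witness_def inst_dim_def inst_mats_def inst_entry_def inst_index_def
    wit_denom_def wit_mat_def wit_size_def wit_vec_def
  by (intro comp_intros comp_pred_scaling_witness) simp_all

lemma witness_exists:
  obtains w where "wit_size w = K" "wit_denom w = q"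
    "\<And>a i j. a < m \<Longrightarrow> i < n \<Longrightarrow> j < n \<Longrightarrow> wit_mat w a i j = Z a i j"
    "\<And>k i. k < K \<Longrightarrow> i < n \<Longrightarrow> wit_vec w k i = Y k i"
proof
  let ?w = "list_encode [K, q,
    list_encode (map (\<lambda>a. list_encode (map (\<lambda>i. list_encode (map (Z a i) [0..<n])) [0..<n])) [0..<m]),
    list_encode (map (\<lambda>k. list_encode (map (Y k) [0..<n])) [0..<K])]"
  show "wit_size ?w = K" "wit_denom ?w = q"
    "\<And>a i j. a < m \<Longrightarrow> i < n \<Longrightarrow> j < n \<Longrightarrow> wit_mat ?w a i j = Z a i j"
    "\<And>k i. k < K \<Longrightarrow> i < n \<Longrightarrow> wit_vec ?w k i = Y k i"
    unfolding wit_size_def wit_denom_def wit_mat_def wit_vec_def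
    by (simp_all add: code_nth_list_encode del: list_encode.simps)
qed

text \<open>A single factor \<open>d\<close> serves all vectors, because the certificate
  inequalities compare different vectors and must survive the scaling.\<close>

lemma natural_vectors:
  assumes "finite Y" "\<forall>y\<in>Y. \<forall>i<n. (0::real) \<le> y i \<and> y i \<in> \<rat>"
  obtains d :: nat and K :: nat and f :: "nat \<Rightarrow> nat \<Rightarrow> nat" where "d \<ge> 1"
    "\<forall>k<K. \<exists>y\<in>Y. \<forall>i<n. real (f k i) = real d * y i"
    "\<forall>y\<in>Y. \<exists>k<K. \<forall>i<n. real (f k i) = real d * y i"
proof -
  define F where "F = (\<lambda>(y, i). y i) ` (Y \<times> {..<n})"
  have F: "finite F" "F \<subseteq> \<rat>" "\<And>x. x \<in> F \<Longrightarrow> 0 \<le> x"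
    using assms by (auto simp: F_def)
  have in_F: "y i \<in> F" if "y \<in> Y" "i < n" for y i
    unfolding F_def using that by (auto intro!: rev_image_eqI[of "(y, i)"])
  obtain d where d: "d \<ge> 1" "\<And>x. x \<in> F \<Longrightarrow> \<exists>k::nat. real d * x = real k"
    using common_denominator[OF F] by blast
  obtain h where h: "\<And>x. x \<in> F \<Longrightarrow> real d * x = real (h x)" using d(2) by metis
  obtain ys where ys: "set ys = Y" using finite_list[OF assms(1)] by blast
  show thesis
  proof (rule that[OF d(1)]; intro allI impI ballI)
    show "\<exists>y\<in>Y. \<forall>i<n. real (h ((ys ! k) i)) = real d * y i" if "k < length ys" for k
      using that h in_F ys by (intro bexI[of _ "ys ! k"]) auto
  next
    fix y assume y: "y \<in> Y"
    then obtain k where "k < length ys" "y = ys ! k" using ys by (metis in_set_conv_nth)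
    then show "\<exists>k<length ys. \<forall>i<n. real (h ((ys ! k) i)) = real d * y i"
      using h[OF in_F[OF y]] by auto
  qed
qed

lemma length_le_list_encode: "length xs \<le> list_encode xs"
proof (induction xs)
  case (Cons x xs)
  then show ?case using le_prod_encode_2[of "list_encode xs" x] by simp
qed simp

lemma list_encode_eq_0_iff: "list_encode xs = 0 \<longleftrightarrow> xs = []"
  by (cases xs) auto

lemma code_rat:
  assumes "0 \<le> r"
  shows "0 < code_snd (code_rat r)"
    "real (code_fst (code_rat r)) = real_of_rat r * real (code_snd (code_rat r))"
proof -
  obtain p q where pq: "quotient_of r = (p, q)" by force
  have q: "q > 0" by (rule quotient_of_denom_pos[OF pq])
  have r: "r = of_int p / of_int q" by (rule quotient_of_div[OF pq])
  with assms q have p: "p \<ge> 0" by (simp add: zero_le_divide_iff)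
  have code: "code_rat r = prod_encode (nat p, nat q)" by (simp add: code_rat_def pq)
  show "0 < code_snd (code_rat r)"
    using q by (simp add: code code_snd_def)
  show "real (code_fst (code_rat r)) = real_of_rat r * real (code_snd (code_rat r))"
    unfolding code using p q by (simp add: code_fst_def code_snd_def r of_rat_divide)
qed

section \<open>Soundness and completeness of witnesses for a coded instance\<close>

locale instance_of_stability =
  fixes n :: nat and Ms :: "rat mat list"
  assumes inst: "(n, Ms) \<in> nonneg_rational_instances"
begin

definition c :: nat where "c = code_instance (n, Ms)"
definition A :: "nat \<Rightarrow> real mat" where "A a = map_mat real_of_rat (Ms ! a)"
definition S :: "real mat set" where "S = map_mat real_of_rat ` set Ms"

lemma n: "n \<ge> 1" and Ms_nonempty: "Ms \<noteq> []"
  using inst by (auto simp: nonneg_rational_instances_def)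

lemma carrier: "a < length Ms \<Longrightarrow> Ms ! a \<in> carrier_mat n n"
  using inst by (auto simp: nonneg_rational_instances_def)

lemma entry_nonneg: "a < length Ms \<Longrightarrow> i < n \<Longrightarrow> j < n \<Longrightarrow> 0 \<le> Ms ! a $$ (i, j)"
  using inst carrier[of a] unfolding nonneg_rational_instances_def elements_mat_def
  by (fastforce dest!: nth_mem)

lemma A_entry: "a < length Ms \<Longrightarrow> i < n \<Longrightarrow> j < n \<Longrightarrow> A a $$ (i, j) = real_of_rat (Ms ! a $$ (i, j))"
  using carrier[of a] by (simp add: A_def)

lemma S_eq: "S = A ` {..<length Ms}"
  unfolding S_def A_def set_conv_nth by auto

lemma S: "S \<subseteq> nonneg_mats n" "S \<subseteq> rat_mats n" "finite S" "S \<noteq> {}"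
proof -
  show "S \<subseteq> nonneg_mats n"
    unfolding S_eq nonneg_mats_def using carrier by (auto simp: A_entry entry_nonneg) (auto simp: A_def)
  show "S \<subseteq> rat_mats n" unfolding S_eq rat_mats_def by (auto simp: A_entry)
  show "finite S" by (simp add: S_def)
  show "S \<noteq> {}" using Ms_nonempty by (simp add: S_def)
qed

lemma dim: "inst_dim c = n" and mats: "inst_mats c = list_encode (map code_mat Ms)"
  by (simp_all add: inst_dim_def inst_mats_def c_def code_instance_def code_fst_def code_snd_def)

lemma index_iff: "a < inst_mats c \<and> inst_index c a \<longleftrightarrow> a < length Ms"
  using length_le_list_encode[of "map code_mat Ms"]
  by (auto simp: inst_index_def mats code_drop_list_encode list_encode_eq_0_iff)

lemma all_index: "(\<forall>a<inst_mats c. inst_index c a \<longrightarrow> P a) \<longleftrightarrow> (\<forall>a<length Ms. P a)"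
  using index_iff by blast

lemma ex_index: "(\<exists>a<inst_mats c. inst_index c a \<and> P a) \<longleftrightarrow> (\<exists>a<length Ms. P a)"
  using index_iff by blast

lemma entry: "a < length Ms \<Longrightarrow> i < n \<Longrightarrow> j < n \<Longrightarrow> inst_entry c a i j = code_rat (Ms ! a $$ (i, j))"
  using carrier[of a]
  by (simp add: inst_entry_def mats code_nth_list_encode code_mat_def mat_to_list_def)

lemma scaling_witness_iff:
  "scaling_witness w c \<longleftrightarrow> 0 < wit_denom w \<and>
     (\<forall>a<length Ms. \<forall>i<n. \<forall>j<n. real (wit_mat w a i j) = real (wit_denom w) * A a $$ (i, j))"
proof -
  have "wit_mat w a i j * code_snd (inst_entry c a i j) = wit_denom w * code_fst (inst_entry c a i j)
      \<longleftrightarrow> real (wit_mat w a i j) = real (wit_denom w) * A a $$ (i, j)"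
    if "a < length Ms" "i < n" "j < n" for a i j
  proof -
    let ?r = "Ms ! a $$ (i, j)"
    note r = code_rat[OF entry_nonneg[OF that]]
    have "wit_mat w a i j * code_snd (code_rat ?r) = wit_denom w * code_fst (code_rat ?r) \<longleftrightarrow>
        real (wit_mat w a i j) * real (code_snd (code_rat ?r)) =
        real (wit_denom w) * real (code_fst (code_rat ?r))"
      by (simp only: of_nat_mult[symmetric] of_nat_eq_iff)
    also have "\<dots> \<longleftrightarrow> real (wit_mat w a i j) * real (code_snd (code_rat ?r)) =
        (real (wit_denom w) * real_of_rat ?r) * real (code_snd (code_rat ?r))"
      by (simp add: r(2))
    also have "\<dots> \<longleftrightarrow> real (wit_mat w a i j) = real (wit_denom w) * real_of_rat ?r"
      using r(1) by simp
    finally show ?thesis by (simp add: entry that A_entry)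
  qed
  then show ?thesis unfolding scaling_witness_def all_index dim by simp
qed

lemma mv_scaled:
  assumes "scaling_witness w c" "a < length Ms" "i < n"
  shows "real (\<Sum>j<n. wit_mat w a i j * y j) = real (wit_denom w) * mv n (A a) (\<lambda>j. real (y j)) i"
  using assms by (simp add: scaling_witness_iff mv_def sum_distrib_left mult_ac)

lemma scaling_factor_exists:
  obtains q :: nat and Z :: "nat \<Rightarrow> nat \<Rightarrow> nat \<Rightarrow> nat" where "q \<ge> 1"
    "\<And>a i j. a < length Ms \<Longrightarrow> i < n \<Longrightarrow> j < n \<Longrightarrow> real (Z a i j) = real q * A a $$ (i, j)"
proof -
  define F where "F = (\<lambda>(a, i, j). A a $$ (i, j)) ` ({..<length Ms} \<times> {..<n} \<times> {..<n})"
  have F: "finite F" "F \<subseteq> \<rat>" "\<And>x. x \<in> F \<Longrightarrow> 0 \<le> x"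
    by (auto simp: F_def A_entry entry_nonneg)
  have in_F: "A a $$ (i, j) \<in> F" if "a < length Ms" "i < n" "j < n" for a i j
    unfolding F_def using that by (auto intro!: rev_image_eqI[of "(a, i, j)"])
  obtain q where q: "q \<ge> 1" "\<And>x. x \<in> F \<Longrightarrow> \<exists>k::nat. real q * x = real k"
    using common_denominator[OF F] by blast
  obtain h where h: "\<And>x. x \<in> F \<Longrightarrow> real q * x = real (h x)" using q(2) by metis
  show thesis
    by (rule that[OF q(1), of "\<lambda>a i j. h (A a $$ (i, j))"]) (simp add: h in_F)
qed

lemma stable_if_witness:
  assumes w: "stable_witness w c"
  shows "stable n S"
proof -
  define Y where "Y = (\<lambda>k i. real (wit_vec w k i)) ` {..<wit_size w}"
  have sc: "scaling_witness w c" and K: "0 < wit_size w" and q: "0 < wit_denom w"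
    and pos: "\<And>k i. k < wit_size w \<Longrightarrow> i < n \<Longrightarrow> 0 < wit_vec w k i"
    and contr: "\<And>k a. k < wit_size w \<Longrightarrow> a < length Ms \<Longrightarrow> \<exists>k'<wit_size w. \<forall>i<n.
      (\<Sum>j<n. wit_mat w a i j * wit_vec w k j) < wit_denom w * wit_vec w k' i"
    using w unfolding stable_witness_def all_index dim by (auto simp: scaling_witness_iff)
  show ?thesis
  proof (rule stable_if_contracted_vectors[OF S(1,3) n])
    show "finite Y" "Y \<noteq> {}" using K by (auto simp: Y_def lessThan_empty_iff)
    show "0 < y i" if "y \<in> Y" "i < n" for y i using that pos by (auto simp: Y_def)
  next
    fix y B assume "y \<in> Y" "B \<in> S"
    then obtain k a where k: "k < wit_size w" "y = (\<lambda>i. real (wit_vec w k i))"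
      and a: "a < length Ms" "B = A a" by (auto simp: Y_def S_eq)
    obtain k' where k': "k' < wit_size w" "\<forall>i<n.
      (\<Sum>j<n. wit_mat w a i j * wit_vec w k j) < wit_denom w * wit_vec w k' i"
      using contr[OF k(1) a(1)] by blast
    have "mv n B y i < real (wit_vec w k' i)" if "i < n" for i
    proof -
      have "real (wit_denom w) * mv n B y i < real (wit_denom w * wit_vec w k' i)"
        unfolding k(2) a(2) mv_scaled[OF sc a(1) that, symmetric] using k'(2) that
        by (simp only: of_nat_less_iff)
      then show ?thesis using q by simp
    qed
    then show "\<exists>y'\<in>Y. \<forall>i<n. mv n B y i < y' i" using k'(1) by (auto simp: Y_def)
  qed
qed

lemma not_stable_if_witness:
  assumes w: "unstable_witness w c"
  shows "\<not> stable n S"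
proof -
  define X where "X = (\<lambda>k i. real (wit_vec w k i)) ` {..<wit_size w}"
  obtain k0 i0 where sc: "scaling_witness w c" and q: "0 < wit_denom w"
    and k0: "k0 < wit_size w" "i0 < n" "0 < wit_vec w k0 i0"
    and supp: "\<And>k. k < wit_size w \<Longrightarrow> \<exists>a<length Ms. \<exists>k'<wit_size w. \<forall>i<n.
      wit_denom w * wit_vec w k i \<le> (\<Sum>j<n. wit_mat w a i j * wit_vec w k' j)"
    using w unfolding unstable_witness_def ex_index dim by (auto simp: scaling_witness_iff)
  show ?thesis
  proof (rule not_stable_if_supported_vectors[OF S(1) n])
    show "finite X" by (simp add: X_def)
    show "(\<lambda>i. real (wit_vec w k0 i)) \<in> X" using k0 by (auto simp: X_def)
    show "i0 < n" "0 < real (wit_vec w k0 i0)" using k0 by auto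
  next
    fix x assume "x \<in> X"
    then obtain k where k: "k < wit_size w" "x = (\<lambda>i. real (wit_vec w k i))" by (auto simp: X_def)
    obtain a k' where a: "a < length Ms" and k': "k' < wit_size w" "\<forall>i<n.
      wit_denom w * wit_vec w k i \<le> (\<Sum>j<n. wit_mat w a i j * wit_vec w k' j)"
      using supp[OF k(1)] by blast
    have "x i \<le> mv n (A a) (\<lambda>i. real (wit_vec w k' i)) i" if "i < n" for i
    proof -
      have "real (wit_denom w * wit_vec w k i) \<le>
          real (wit_denom w) * mv n (A a) (\<lambda>i. real (wit_vec w k' i)) i"
        unfolding mv_scaled[OF sc a that, symmetric] using k'(2) that by (simp only: of_nat_le_iff)
      then show ?thesis using q by (simp add: k(2))
    qed
    moreover have "A a \<in> S" using a by (simp add: S_eq)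
    ultimately show "\<exists>B\<in>S. \<exists>x'\<in>X. \<forall>i<n. x i \<le> mv n B x' i"
      using k'(1) by (auto simp: X_def)
  qed
qed

lemma mv_cong: "(\<And>j. j < n \<Longrightarrow> v j = v' j) \<Longrightarrow> mv n B v i = mv n B v' i"
  by (simp add: mv_def)

lemma witness_if_stable:
  assumes "stable n S"
  shows "\<exists>w. stable_witness w c"
proof -
  obtain Y where Y: "finite Y" "Y \<noteq> {}" "\<And>y i. y \<in> Y \<Longrightarrow> i < n \<Longrightarrow> (0::real) < y i \<and> y i \<in> \<rat>"
    "\<And>y B. y \<in> Y \<Longrightarrow> B \<in> S \<Longrightarrow> \<exists>y'\<in>Y. \<forall>i<n. mv n B y i < y' i"
    using contracted_vectors_if_stable[OF S(1-3) n assms] by blast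
  have "\<forall>y\<in>Y. \<forall>i<n. 0 \<le> y i \<and> y i \<in> \<rat>" using Y(3) by (auto intro: less_imp_le)
  from natural_vectors[OF Y(1) this] obtain d K :: nat and f :: "nat \<Rightarrow> nat \<Rightarrow> nat" where d: "d \<ge> 1"
    and f: "\<forall>k<K. \<exists>y\<in>Y. \<forall>i<n. real (f k i) = real d * y i"
      "\<forall>y\<in>Y. \<exists>k<K. \<forall>i<n. real (f k i) = real d * y i"
    .
  note f = f[rule_format]
  obtain q Z where q: "q \<ge> 1"
    and Z: "\<And>a i j. a < length Ms \<Longrightarrow> i < n \<Longrightarrow> j < n \<Longrightarrow> real (Z a i j) = real q * A a $$ (i, j)"
    using scaling_factor_exists by blast
  obtain w where w: "wit_size w = K" "wit_denom w = q"
    "\<And>a i j. a < length Ms \<Longrightarrow> i < n \<Longrightarrow> j < n \<Longrightarrow> wit_mat w a i j = Z a i j"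
    "\<And>k i. k < K \<Longrightarrow> i < n \<Longrightarrow> wit_vec w k i = f k i"
    using witness_exists[of K q "length Ms" n Z f] by blast
  have sc: "scaling_witness w c" using q by (simp add: scaling_witness_iff w Z)
  have "0 < K" using Y(2) f(2) by fastforce
  moreover have "0 < wit_vec w k i" if k: "k < K" "i < n" for k i
  proof -
    obtain y where "y \<in> Y" "real (f k i) = real d * y i" using f(1)[OF k(1)] k(2) by blast
    then have "0 < real (f k i)" using Y(3)[of y i] k d by simp
    then show ?thesis using w(4)[OF k] by simp
  qed
  moreover have "\<exists>k'<K. \<forall>i<n. (\<Sum>j<n. wit_mat w a i j * wit_vec w k j) < q * wit_vec w k' i"
    if k: "k < K" and a: "a < length Ms" for k a
  proof -
    obtain y where y: "y \<in> Y" "\<forall>i<n. real (f k i) = real d * y i" using f(1)[OF k] by blast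
    have "A a \<in> S" using a by (simp add: S_eq)
    then obtain y' where y': "y' \<in> Y" "\<forall>i<n. mv n (A a) y i < y' i" using Y(4)[OF y(1)] by blast
    obtain k' where k': "k' < K" "\<forall>i<n. real (f k' i) = real d * y' i" using f(2)[OF y'(1)] by blast
    have "(\<Sum>j<n. wit_mat w a i j * wit_vec w k j) < q * wit_vec w k' i" if i: "i < n" for i
    proof -
      have "real (\<Sum>j<n. wit_mat w a i j * wit_vec w k j) = real q * mv n (A a) (\<lambda>j. real d * y j) i"
        unfolding mv_scaled[OF sc a i] w(2) using y(2) k
        by (intro arg_cong2[of _ _ _ _ "(*)"] refl mv_cong) (simp add: w(4))
      also have "\<dots> < real q * (real d * y' i)"
        using y'(2) i q d by (simp add: mv_scale)
      also have "\<dots> = real (q * wit_vec w k' i)" using k' i by (simp add: w(4))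
      finally show ?thesis by (simp only: of_nat_less_iff)
    qed
    then show ?thesis using k'(1) by blast
  qed
  ultimately show ?thesis
    unfolding stable_witness_def all_index dim using sc w(1,2) by auto
qed

lemma witness_if_not_stable:
  assumes fp: "\<And>(N::nat) (A::real mat) (B::real mat).
      \<lbrakk>N \<ge> 1; A \<in> carrier_mat N N; B \<in> carrier_mat N N; binary_mat A; binary_mat B\<rbrakk>
      \<Longrightarrow> finiteness_property N {A, B}"
    and unstable: "\<not> stable n S"
  shows "\<exists>w. unstable_witness w c"
proof -
  obtain As and x :: "nat \<Rightarrow> real" where x: "set As \<subseteq> S" "As \<noteq> []"
    "\<forall>i<n. 0 \<le> x i \<and> x i \<in> \<rat>" "\<exists>i<n. 0 < x i" "\<forall>i<n. x i \<le> act n As x i"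
    by (rule periodic_if_not_stable[OF fp S n unstable])
  from supported_vectors_if_periodic[OF S(1,2) x] obtain X :: "(nat \<Rightarrow> real) set"
    where X: "finite X" "\<exists>x\<in>X. \<exists>i<n. 0 < x i" "\<forall>x\<in>X. \<forall>i<n. 0 \<le> x i \<and> x i \<in> \<rat>"
      "\<forall>x\<in>X. \<exists>B\<in>S. \<exists>x'\<in>X. \<forall>i<n. x i \<le> mv n B x' i" .
  obtain x0 i0 where x0: "x0 \<in> X" "i0 < n" "0 < x0 i0" using X(2) by blast
  from natural_vectors[OF X(1,3)] obtain d K :: nat and f :: "nat \<Rightarrow> nat \<Rightarrow> nat" where d: "d \<ge> 1"
    and f: "\<forall>k<K. \<exists>y\<in>X. \<forall>i<n. real (f k i) = real d * y i"
      "\<forall>y\<in>X. \<exists>k<K. \<forall>i<n. real (f k i) = real d * y i"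
    .
  note f = f[rule_format]
  obtain q Z where q: "q \<ge> 1"
    and Z: "\<And>a i j. a < length Ms \<Longrightarrow> i < n \<Longrightarrow> j < n \<Longrightarrow> real (Z a i j) = real q * A a $$ (i, j)"
    using scaling_factor_exists by blast
  obtain w where w: "wit_size w = K" "wit_denom w = q"
    "\<And>a i j. a < length Ms \<Longrightarrow> i < n \<Longrightarrow> j < n \<Longrightarrow> wit_mat w a i j = Z a i j"
    "\<And>k i. k < K \<Longrightarrow> i < n \<Longrightarrow> wit_vec w k i = f k i"
    using witness_exists[of K q "length Ms" n Z f] by blast
  have sc: "scaling_witness w c" using q by (simp add: scaling_witness_iff w Z)
  obtain k0 where k0: "k0 < K" "\<forall>i<n. real (f k0 i) = real d * x0 i" using f(2)[OF x0(1)] by blast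
  have "0 < real (f k0 i0)" using k0 x0 d by simp
  then have "0 < wit_vec w k0 i0" using w(4)[OF k0(1) x0(2)] by simp
  then have "\<exists>k<K. \<exists>i<n. 0 < wit_vec w k i" using k0(1) x0(2) by blast
  moreover have "\<exists>a<length Ms. \<exists>k'<K. \<forall>i<n.
      q * wit_vec w k i \<le> (\<Sum>j<n. wit_mat w a i j * wit_vec w k' j)" if k: "k < K" for k
  proof -
    obtain y where y: "y \<in> X" "\<forall>i<n. real (f k i) = real d * y i" using f(1)[OF k] by blast
    obtain B y' where B: "B \<in> S" and y': "y' \<in> X" "\<forall>i<n. y i \<le> mv n B y' i"
      using X(4) y(1) by blast
    obtain a where a: "a < length Ms" "B = A a" using B by (auto simp: S_eq)
    obtain k' where k': "k' < K" "\<forall>i<n. real (f k' i) = real d * y' i" using f(2)[OF y'(1)] by blast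
    have "q * wit_vec w k i \<le> (\<Sum>j<n. wit_mat w a i j * wit_vec w k' j)" if i: "i < n" for i
    proof -
      have "real (q * wit_vec w k i) = real q * (real d * y i)" using y k i by (simp add: w(4))
      also have "\<dots> \<le> real q * mv n (A a) (\<lambda>j. real d * y' j) i"
        using y'(2) i by (simp add: mv_scale a(2) mult_left_mono)
      also have "\<dots> = real (\<Sum>j<n. wit_mat w a i j * wit_vec w k' j)"
        unfolding mv_scaled[OF sc a(1) i] w(2) using k'
        by (intro arg_cong2[of _ _ _ _ "(*)"] refl mv_cong) (simp add: w(4))
      finally show ?thesis by (simp only: of_nat_le_iff)
    qed
    then show ?thesis using a(1) k'(1) by blast
  qed
  ultimately show ?thesis
    unfolding unstable_witness_def ex_index dim using sc w(1,2) by auto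
qed

end

theorem mainTheorem4:
  assumes "\<And>(n::nat) (A::real mat) (B::real mat).
      \<lbrakk>n \<ge> 1; A \<in> carrier_mat n n; B \<in> carrier_mat n n; binary_mat A; binary_mat B\<rbrakk>
      \<Longrightarrow> finiteness_property n {A, B}"
  shows "decidable_problem code_instance nonneg_rational_instances stable_instance"
proof (rule decidable_problem_by_witnesses[OF comp_pred_stable_witness comp_pred_unstable_witness])
  fix x assume x: "x \<in> nonneg_rational_instances"
  obtain n Ms where x_eq: "x = (n, Ms)" by (cases x)
  interpret instance_of_stability n Ms
    using x by unfold_locales (simp add: x_eq)
  have stable_x: "stable_instance x \<longleftrightarrow> stable n S" by (simp add: stable_instance_def x_eq S_def)
  have code_x: "code_instance x = c" by (simp add: c_def x_eq)
  show "stable_instance x \<longleftrightarrow> (\<exists>w. stable_witness w (code_instance x))"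
    unfolding stable_x code_x using stable_if_witness witness_if_stable by blast
  show "\<not> stable_instance x \<longleftrightarrow> (\<exists>w. unstable_witness w (code_instance x))"
    unfolding stable_x code_x using not_stable_if_witness witness_if_not_stable[OF assms] by blast
qed

end
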